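(* For all $\beta>0$, all $k=1,\ldots,N$, and all starting points $x_0\in C_N^A$ of the renormalized Bessel process $(\tilde X_t)_{t\ge 0}=(\tilde X_t^\beta)_{t\ge0}$ of type $A_{N-1}$, the process $$\Biggl( e^N_k(\tilde X_{t}) + \sum_{l=1}^{\lfloor k/2\rfloor} \frac{(N-k+2l)!}{2^l\cdot l!\cdot (N-k)!}\, t^l\cdot e^N_{k-2l}(\tilde X_{t})\Biggr)_{t\ge0}$$ is a martingale.
   Context: Let $N\ge 2$ and $C_N^A:=\{x\in\mathbb R^N: x_1\ge x_2\ge\ldots\ge x_N\}$. For $\beta>0$, the Bessel process $(X_t^\beta)_{t\ge0}$ of type $A_{N-1}$ with multiplicity $\beta$ is the diffusion with values in $C_N^A$ whose generator is $\frac12\Delta f+\beta\sum_{i=1}^N\bigl(\sum_{j\ne i}\frac{1}{x_i-x_j}\bigr)\frac{\partial f}{\partial x_i}$ with reflecting boundaries (the domain being the restrictions to $C_N^A$ of the permutation-invariant $C^{2}$-functions on $\mathbb R^N$). Equivalently, for every deterministic starting point in $C_N^A$ it is the unique strong solution with values in $C_N^A$ (existence and uniqueness for every $\beta>0$ are known) of $$dX_{t,i}^\beta = dB_{t,i}+ \beta\sum_{j\ne i} \frac{1}{X_{t,i}^\beta-X_{t,j}^\beta}\, dt \quad (i=1,\ldots,N),$$ where $(B_t)_{t\ge0}$ is an $N$-dimensional Brownian motion. The renormalized process is $\tilde X_t=\tilde X_t^\beta:=X_t^\beta/\sqrt\beta$; it satisfies $d\tilde X_{t,i} =\frac{1}{\sqrt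 \beta}dB_{t,i} + \sum_{j\ne i}\frac{1}{\tilde X_{t,i}-\tilde X_{t,j}}dt$. Martingales are understood with respect to the canonical filtration of the Brownian motion $(B_t)_{t\ge0}$. $e_k^N$ denotes the $k$-th elementary symmetric polynomial in $N$ variables ($e^N_0=1$). *)

theory Defs
  imports "HOL-Probability.Probability"
begin

text \<open>
  Vectors in dimension \<open>N\<close> have type \<open>real ^ 'n\<close> with \<open>N = CARD('n)\<close>, where the index type \<open>'n\<close>
  is finite and linearly ordered; its order plays the role of \<open>1 < 2 < \<dots> < N\<close>.
  Processes are indexed by \<open>real\<close>, and only times \<open>t \<ge> 0\<close> matter.
\<close>

definition chamber_A :: "(real ^ 'n::{finite,linorder}) set" where
  "chamber_A = {x. \<forall>i j. i \<le> j \<longrightarrow> x $ j \<le> x $ i}"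

definition esym :: "nat \<Rightarrow> real ^ 'n::finite \<Rightarrow> real" where
  "esym k x = (\<Sum>S | card S = k. \<Prod>i\<in>S. x $ i)"

definition raw_filtration ::
  "'a measure \<Rightarrow> (real \<Rightarrow> 'a \<Rightarrow> real ^ 'n::finite) \<Rightarrow> real \<Rightarrow> 'a measure" where
  "raw_filtration M B t =
     sigma (space M) {B s -` A \<inter> space M | s A. 0 \<le> s \<and> s \<le> t \<and> A \<in> sets borel}"

text \<open>
  The canonical filtration is augmented by the null sets of \<open>M\<close>, as is usual for strong solutions:
  these are in general adapted only to the augmented filtration.
\<close>

definition canonical_filtration ::
  "'a measure \<Rightarrow> (real \<Rightarrow> 'a \<Rightarrow> real ^ 'n::finite) \<Rightarrow> real \<Rightarrow> 'a measure" where
  "canonical_filtration M B t = sigma (space M) (sets (raw_filtration M B t) \<union> null_sets M)"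

text \<open>
  The third conjunct says that \<open>B t - B s\<close> has law \<open>N(0, (t - s) I)\<close>.
\<close>

definition brownian_motion ::
  "'a measure \<Rightarrow> (real \<Rightarrow> 'a \<Rightarrow> real ^ 'n::finite) \<Rightarrow> bool" where
  "brownian_motion M B \<longleftrightarrow>
     (\<forall>t\<ge>0. B t \<in> borel_measurable M) \<and>
     (AE \<omega> in M. B 0 \<omega> = 0) \<and>
     (\<forall>s t. 0 \<le> s \<and> s < t \<longrightarrow>
        distributed M lborel (\<lambda>\<omega>. B t \<omega> - B s \<omega>)
          (\<lambda>x. ennreal (\<Prod>i\<in>UNIV. normal_density 0 (sqrt (t - s)) (x $ i)))) \<and>
     (\<forall>s t. 0 \<le> s \<and> s < t \<longrightarrow>
        prob_space.indep_set M (sets (raw_filtration M B s))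
          {(\<lambda>\<omega>. B t \<omega> - B s \<omega>) -` A \<inter> space M | A. A \<in> sets borel}) \<and>
     (AE \<omega> in M. continuous_on {0..} (\<lambda>t. B t \<omega>))"

definition martingale ::
  "'a measure \<Rightarrow> (real \<Rightarrow> 'a measure) \<Rightarrow> (real \<Rightarrow> 'a \<Rightarrow> real) \<Rightarrow> bool" where
  "martingale M F Z \<longleftrightarrow>
     (\<forall>t\<ge>0. subalgebra M (F t)) \<and>
     (\<forall>s t. 0 \<le> s \<and> s \<le> t \<longrightarrow> subalgebra (F t) (F s)) \<and>
     (\<forall>t\<ge>0. Z t \<in> borel_measurable (F t)) \<and>
     (\<forall>t\<ge>0. integrable M (Z t)) \<and>
     (\<forall>s t. 0 \<le> s \<and> s \<le> t \<longrightarrow>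
        (AE \<omega> in M. real_cond_exp M (F s) (Z t) \<omega> = Z s \<omega>))"

definition drift_A :: "'n::finite \<Rightarrow> real ^ 'n::finite \<Rightarrow> real" where
  "drift_A i x = (\<Sum>j\<in>UNIV - {i}. 1 / (x $ i - x $ j))"

text \<open>
  \<open>X\<close> is a strong solution with values in the closed chamber, started in \<open>x\<close>, of
  \<open>dX\<^sub>i = dB\<^sub>i + \<beta> \<Sum>\<^sub>j\<^sub>\<noteq>\<^sub>i 1 / (X\<^sub>i - X\<^sub>j) dt\<close>. The noise is additive, so the integral form of the equation
  needs only a pathwise Lebesgue integral. As \<open>1 / 0 = 0\<close> here, it is required explicitly
  that the drift is a genuine quotient at almost every time.
\<close>

definition bessel_process_A ::
  "'a measure \<Rightarrow> (real \<Rightarrow> 'a \<Rightarrow> real ^ 'n::{finite,linorder}) \<Rightarrow> real \<Rightarrow> real ^ 'n::{finite,linorder}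
     \<Rightarrow> (real \<Rightarrow> 'a \<Rightarrow> real ^ 'n::{finite,linorder}) \<Rightarrow> bool" where
  "bessel_process_A M B \<beta> x X \<longleftrightarrow>
     (\<forall>t\<ge>0. X t \<in> borel_measurable (canonical_filtration M B t)) \<and>
     (AE \<omega> in M. continuous_on {0..} (\<lambda>t. X t \<omega>)) \<and>
     (AE \<omega> in M. \<forall>t\<ge>0. X t \<omega> \<in> chamber_A) \<and>
     (AE \<omega> in M. AE s in lborel. 0 \<le> s \<longrightarrow> (\<forall>i j. i \<noteq> j \<longrightarrow> X s \<omega> $ i \<noteq> X s \<omega> $ j)) \<and>
     (AE \<omega> in M. \<forall>t\<ge>0. \<forall>i.
        set_integrable lborel {0..t} (\<lambda>s. drift_A i (X s \<omega>)) \<and>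
        X t \<omega> $ i = x $ i + B t \<omega> $ i + \<beta> * (LBINT s:{0..t}. drift_A i (X s \<omega>)))"

definition renormalize ::
  "real \<Rightarrow> (real \<Rightarrow> 'a \<Rightarrow> real ^ 'n::finite) \<Rightarrow> real \<Rightarrow> 'a \<Rightarrow> real ^ 'n::finite" where
  "renormalize \<beta> X t \<omega> = (1 / sqrt \<beta>) *\<^sub>R X t \<omega>"

end

theory Submission
  imports Defs
begin

text \<open>
  Write \<open>G(t, x)\<close> for the space-time polynomial in question and \<open>Y\<close> for the renormalized process, so
  that \<open>Y = y + B / sqrt \<beta>\<close> where \<open>y\<close> has the drift as its density. By the formula of Ito, \<open>G(t, Y\<^sub>t)\<close>
  is a martingale as soon as \<open>(\<partial>\<^sub>t + L) G = 0\<close> for the generator \<open>L\<close> and everything is integrable. The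
  second-order part of \<open>L\<close> drops out because each \<open>e\<^sub>k\<close> is affine in each variable; it is the only
  place where \<open>\<beta>\<close> enters \<open>L\<close>, so \<open>G\<close> is free of \<open>\<beta>\<close>. The first-order part is computed in
  \<open>drift_esym\<close>: after symmetrization over pairs of particles it maps \<open>e\<^sub>k\<close> to a multiple of \<open>e\<^sub>k\<^sub>-\<^sub>2\<close>, and
  the coefficients of \<open>G\<close> are those for which time derivatives and drift terms telescope
  (\<open>heat_gradient_drift\<close>).

  Affinity also permits an argument without stochastic integration. On a grid of \<open>[s, t]\<close>, the increment
  of \<open>G\<close> over a cell splits into the step that adds only the Brownian increment and the step that moves
  time and \<open>y\<close>. Expanding the products shows that the first step has conditional mean exactly zero
  (\<open>esym_plus_increment\<close>). The second steps add up to a Riemann sum for the ordinary, pathwise integral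
  of \<open>\<nabla>G \<bullet> (1, drift)\<close> (\<open>riemann_sum_tendsto\<close>), whose integrand vanishes at almost every time. So the
  mean of \<open>G(t, Y\<^sub>t) - G(s, Y\<^sub>s)\<close> on an event of the past is, for each grid, the mean of
  a quantity that tends to zero almost surely.

  It remains to dominate these sums. A deterministic energy estimate (\<open>a_priori_bounds\<close>) compares \<open>y\<close>
  with a configuration \<open>a\<close> of well-separated particles: the repulsion only decreases \<open>\<bar>y - a\<bar>\<^sup>2\<close>, up to
  linear growth in time, once the gaps of \<open>a\<close> exceed the oscillation of the noise, and the surplus
  bounds the total variation of the singular drift. Hence everything is bounded by a power of the
  running maximum of Brownian motion, which has all moments by dyadic chaining
  (\<open>brownian_sup_moment\<close>).
\<close>


section \<open>Elementary symmetric polynomials and the singular drift\<close>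

text \<open>
  Restricting the variables to an index set \<open>A\<close> makes the family closed under differentiation:
  the partial derivatives of \<open>esym\<close> are again of this form, and so are, up to sign, the divided
  differences of these.
\<close>

definition esym_on :: "'n set \<Rightarrow> nat \<Rightarrow> real ^ 'n::finite \<Rightarrow> real" where
  "esym_on A k x = (\<Sum>S | S \<subseteq> A \<and> card S = k. \<Prod>i\<in>S. x $ i)"

lemma esym_on_0: "esym_on A 0 x = 1"
proof -
  have "{S. S \<subseteq> A \<and> card S = 0} = {{}}" by auto
  then show ?thesis by (simp add: esym_on_def)
qed

lemma sum_subsets_containing:
  fixes f :: "'n::finite set \<Rightarrow> real"
  assumes "j \<in> A"
  shows "(\<Sum>S | S \<subseteq> A \<and> j \<in> S \<and> card S = Suc k. f S)
         = (\<Sum>R | R \<subseteq> A - {j} \<and> card R = k. f (insert j R))"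
proof (rule sum.reindex_bij_witness[where i="insert j" and j="\<lambda>S. S - {j}"])
qed (use assms in \<open>auto simp: insert_absorb card_insert_if\<close>)

text \<open>
  The polynomial is affine in each variable: the index sets avoiding \<open>j\<close> give the constant term,
  those containing \<open>j\<close> the slope.
\<close>

lemma esym_on_Suc:
  fixes x :: "real ^ 'n::finite"
  assumes "j \<in> A"
  shows "esym_on A (Suc k) x = esym_on (A - {j}) (Suc k) x + x $ j * esym_on (A - {j}) k x"
proof -
  have "{S. S \<subseteq> A \<and> card S = Suc k} = {S. S \<subseteq> A - {j} \<and> card S = Suc k} \<union> {S. S \<subseteq> A \<and> j \<in> S \<and> card S = Suc k}"
    by auto
  then have "esym_on A (Suc k) x = esym_on (A - {j}) (Suc k) x
      + (\<Sum>S | S \<subseteq> A \<and> j \<in> S \<and> card S = Suc k. \<Prod>i\<in>S. x $ i)"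
    unfolding esym_on_def by (subst sum.union_disjoint[symmetric]) auto
  also have "(\<Sum>S | S \<subseteq> A \<and> j \<in> S \<and> card S = Suc k. \<Prod>i\<in>S. x $ i)
     = (\<Sum>R | R \<subseteq> A - {j} \<and> card R = k. x $ j * (\<Prod>i\<in>R. x $ i))"
    unfolding sum_subsets_containing[OF assms]
    by (intro sum.cong refl prod.insert) auto
  also have "\<dots> = x $ j * esym_on (A - {j}) k x"
    by (simp add: esym_on_def sum_distrib_left)
  finally show ?thesis .
qed

text \<open>
  By affinity, the derivative of \<open>esym k\<close> in the variable \<open>x $ i\<close> is the coefficient of this variable.
\<close>

definition esym_partial :: "nat \<Rightarrow> 'n \<Rightarrow> real ^ 'n::finite \<Rightarrow> real" where
  "esym_partial k i x = (case k of 0 \<Rightarrow> 0 | Suc m \<Rightarrow> esym_on (UNIV - {i}) m x)"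

lemma esym_partial_eq:
  "esym_partial k i x = (\<Sum>S | i \<in> S \<and> card S = k. \<Prod>j\<in>S - {i}. x $ j)"
proof (cases k)
  case 0
  have "{S. i \<in> S \<and> card S = 0} = {}" by auto
  then show ?thesis using 0 unfolding esym_partial_def by simp
next
  case (Suc m)
  have "(\<Sum>S | i \<in> S \<and> card S = Suc m. \<Prod>j\<in>S - {i}. x $ j)
      = (\<Sum>S | S \<subseteq> UNIV \<and> i \<in> S \<and> card S = Suc m. \<Prod>j\<in>S - {i}. x $ j)" by simp
  also have "\<dots> = (\<Sum>R | R \<subseteq> UNIV - {i} \<and> card R = m. \<Prod>j\<in>insert i R - {i}. x $ j)"
    by (rule sum_subsets_containing) simp
  also have "\<dots> = esym_on (UNIV - {i}) m x"
    unfolding esym_on_def by (intro sum.cong refl prod.cong) auto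
  finally show ?thesis using Suc by (simp add: esym_partial_def)
qed

lemma esym_has_derivative:
  fixes x :: "real ^ 'n::finite"
  shows "(esym k has_derivative (\<lambda>h. \<Sum>i\<in>UNIV. esym_partial k i x * h $ i)) (at x)"
proof -
  have "((\<lambda>x. esym k x) has_derivative
      (\<lambda>h. \<Sum>S | card S = k. \<Sum>i\<in>S. h $ i * (\<Prod>j\<in>S - {i}. x $ j))) (at x)"
    unfolding esym_def
    by (intro has_derivative_sum has_derivative_prod bounded_linear_imp_has_derivative
        bounded_linear_vec_nth)
  moreover have "(\<Sum>S | card S = k. \<Sum>i\<in>S. h $ i * (\<Prod>j\<in>S - {i}. x $ j))
     = (\<Sum>i\<in>UNIV. esym_partial k i x * h $ i)" for h :: "real ^ 'n"
  proof -
    have "(\<Sum>S | card S = k. \<Sum>i\<in>S. h $ i * (\<Prod>j\<in>S - {i}. x $ j))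
       = (\<Sum>S | card S = k. \<Sum>i\<in>{i\<in>UNIV. i \<in> S}. h $ i * (\<Prod>j\<in>S - {i}. x $ j))" by simp
    also have "\<dots> = (\<Sum>i\<in>UNIV. \<Sum>S | S \<in> {S. card S = k} \<and> i \<in> S. h $ i * (\<Prod>j\<in>S - {i}. x $ j))"
      by (rule sum.swap_restrict) auto
    also have "\<dots> = (\<Sum>i\<in>UNIV. esym_partial k i x * h $ i)"
      unfolding esym_partial_eq sum_distrib_right
      by (intro sum.cong) auto
    finally show ?thesis .
  qed
  ultimately show ?thesis by simp
qed

text \<open>
  The kernel \<open>1 / (x\<^sub>i - x\<^sub>j)\<close> is antisymmetric, so averaging the double sum with its transpose
  replaces the singular quotients by divided differences of \<open>z\<close>. This is the only way in which
  the drift is ever evaluated: with \<open>z\<close> a gradient of a symmetric polynomial, and with \<open>z\<close> a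
  displacement of the particles.
\<close>

lemma sum_drift_A_symmetrize:
  fixes x :: "real ^ 'n::finite"
  shows "(\<Sum>i\<in>UNIV. z i * drift_A i x) = (\<Sum>i\<in>UNIV. \<Sum>j\<in>UNIV - {i}. (z i - z j) / (x $ i - x $ j)) / 2"
proof -
  let ?f = "\<lambda>i j. z i / (x $ i - x $ j)"
  have a: "(\<Sum>i\<in>UNIV. z i * drift_A i x) = (\<Sum>i\<in>UNIV. \<Sum>j\<in>UNIV - {i}. ?f i j)"
    by (simp add: drift_A_def sum_distrib_left)
  have "(\<Sum>i\<in>UNIV. \<Sum>j\<in>UNIV - {i}. ?f i j) = (\<Sum>i\<in>UNIV. \<Sum>j | j \<in> UNIV \<and> j \<noteq> i. ?f i j)"
    by (intro sum.cong) auto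
  also have "\<dots> = (\<Sum>j\<in>UNIV. \<Sum>i | i \<in> UNIV \<and> j \<noteq> i. ?f i j)"
    by (rule sum.swap_restrict) auto
  also have "\<dots> = (\<Sum>j\<in>UNIV. \<Sum>i\<in>UNIV - {j}. - z i / (x $ j - x $ i))"
    by (intro sum.cong) (auto simp: minus_divide_left[symmetric] minus_divide_right)
  finally have b: "(\<Sum>i\<in>UNIV. \<Sum>j\<in>UNIV - {i}. ?f i j) = (\<Sum>i\<in>UNIV. \<Sum>j\<in>UNIV - {i}. - z j / (x $ i - x $ j))" .
  have "(\<Sum>i\<in>UNIV. \<Sum>j\<in>UNIV - {i}. (z i - z j) / (x $ i - x $ j))
      = (\<Sum>i\<in>UNIV. \<Sum>j\<in>UNIV - {i}. ?f i j) + (\<Sum>i\<in>UNIV. \<Sum>j\<in>UNIV - {i}. - z j / (x $ i - x $ j))"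
    by (simp add: sum.distrib[symmetric] diff_divide_distrib)
  then show ?thesis using a b by simp
qed

text \<open>
  Double counting: a set \<open>R\<close> of size \<open>m\<close> contributes once for each ordered pair of distinct
  indices outside \<open>R\<close>.
\<close>

lemma sum_esym_on_two_removed:
  fixes x :: "real ^ 'n::finite"
  assumes "m \<le> CARD('n)"
  shows "(\<Sum>i\<in>UNIV. \<Sum>j\<in>UNIV - {i}. esym_on (UNIV - {i} - {j}) m x)
     = (real (CARD('n) - m)) * (real (CARD('n) - m) - 1) * esym m x"
proof -
  have "(\<Sum>i\<in>UNIV. \<Sum>j\<in>UNIV - {i}. esym_on (UNIV - {i} - {j}) m x)
     = (\<Sum>p\<in>(SIGMA i:UNIV. UNIV - {i}). \<Sum>R | R \<in> {R. card R = m} \<and> fst p \<notin> R \<and> snd p \<notin> R. \<Prod>i\<in>R. x $ i)"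
    unfolding esym_on_def
    by (subst sum.Sigma) (auto intro!: sum.cong)
  also have "\<dots> = (\<Sum>R | card R = m. \<Sum>p | p \<in> (SIGMA i:UNIV. UNIV - {i}) \<and> fst p \<notin> R \<and> snd p \<notin> R. \<Prod>i\<in>R. x $ i)"
    by (rule sum.swap_restrict) auto
  also have "\<dots> = (\<Sum>R | card R = m. (real (CARD('n) - m)) * (real (CARD('n) - m) - 1) * (\<Prod>i\<in>R. x $ i))"
  proof (intro sum.cong refl)
    fix R :: "'n set" assume "R \<in> {R. card R = m}"
    then have R: "card (- R) = CARD('n) - m" by (simp add: Compl_eq_Diff_UNIV card_Diff_subset)
    have "{p. p \<in> (SIGMA i:UNIV. UNIV - {i}) \<and> fst p \<notin> R \<and> snd p \<notin> R} = (SIGMA i:-R. -R - {i})"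
      by auto
    moreover have "card (SIGMA i:-R. -R - {i}) = (CARD('n) - m) * (CARD('n) - m - 1)"
      by (subst card_SigmaI) (auto simp: R card_Diff_subset)
    moreover have "real (a * (a - 1)) = real a * (real a - 1)" for a
      by (cases a) (auto simp: algebra_simps)
    ultimately have "real (card {p. p \<in> (SIGMA i:UNIV. UNIV - {i}) \<and> fst p \<notin> R \<and> snd p \<notin> R})
       = real (CARD('n) - m) * (real (CARD('n) - m) - 1)"
      by (simp only:)
    then show "(\<Sum>p | p \<in> (SIGMA i:UNIV. UNIV - {i}) \<and> fst p \<notin> R \<and> snd p \<notin> R. \<Prod>i\<in>R. x $ i)
       = (real (CARD('n) - m)) * (real (CARD('n) - m) - 1) * (\<Prod>i\<in>R. x $ i)"
      by simp
  qed
  also have "\<dots> = (real (CARD('n) - m)) * (real (CARD('n) - m) - 1) * esym m x"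
    by (simp add: esym_def sum_distrib_left)
  finally show ?thesis .
qed

text \<open>
  The singularities cancel. By affinity in each variable,
  \<open>\<partial>\<^sub>i e\<^sub>k - \<partial>\<^sub>j e\<^sub>k = - (x\<^sub>i - x\<^sub>j) e\<^sub>k\<^sub>-\<^sub>2\<close> with \<open>x\<^sub>i\<close> and \<open>x\<^sub>j\<close> left out, so the divided
  differences in the symmetrized drift are polynomials, and they add up to a multiple of \<open>e\<^sub>k\<^sub>-\<^sub>2\<close>.
\<close>

lemma drift_esym:
  fixes x :: "real ^ 'n::finite"
  assumes dist: "\<And>i j. i \<noteq> j \<Longrightarrow> x $ i \<noteq> x $ j" and k: "k \<le> CARD('n)"
  shows "(\<Sum>i\<in>UNIV. esym_partial k i x * drift_A i x)
     = (if k < 2 then 0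
        else - (real (CARD('n) - k + 2) * real (CARD('n) - k + 1) / 2) * esym (k - 2) x)"
proof -
  consider "k < 2" | m where "k = Suc (Suc m)"
    by (metis add_2_eq_Suc le_Suc_ex not_less)
  then show ?thesis
  proof cases
    case 1
    then have "esym_partial k i x = esym_partial k j x" for i j
      by (cases k) (auto simp: esym_partial_def esym_on_0)
    then have const: "esym_partial k i x - esym_partial k j x = 0" for i j
      by (metis diff_self)
    show ?thesis using 1 by (simp only: sum_drift_A_symmetrize const) simp
  next
    case (2 m)
    have diff: "esym_partial k i x - esym_partial k j x
       = - (x $ i - x $ j) * esym_on (UNIV - {i} - {j}) m x" if "j \<noteq> i" for i j
    proof -
      have "UNIV - {j} - {i} = UNIV - {i} - {j}" by auto
      then show ?thesis using that 2 esym_on_Suc[of j "UNIV - {i}" m x] esym_on_Suc[of i "UNIV - {j}" m x]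
        by (simp add: esym_partial_def algebra_simps)
    qed
    have "(\<Sum>i\<in>UNIV. esym_partial k i x * drift_A i x)
       = (\<Sum>i\<in>UNIV. \<Sum>j\<in>UNIV - {i}. - esym_on (UNIV - {i} - {j}) m x) / 2"
      unfolding sum_drift_A_symmetrize
    proof (intro arg_cong2[of _ _ _ _ "(/)"] sum.cong refl)
      fix i j :: 'n assume "j \<in> UNIV - {i}"
      then show "(esym_partial k i x - esym_partial k j x) / (x $ i - x $ j)
         = - esym_on (UNIV - {i} - {j}) m x"
        using dist[of i j] diff[of j i] by (simp add: divide_simps) (simp add: algebra_simps)
    qed
    also have "\<dots> = - ((real (CARD('n) - m)) * (real (CARD('n) - m) - 1) / 2) * esym m x"
      using sum_esym_on_two_removed[of m x] k 2 by (simp add: sum_negf)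
    also have "\<dots> = - (real (CARD('n) - k + 2) * real (CARD('n) - k + 1) / 2) * esym m x"
      using k 2 by (auto simp: of_nat_diff)
    finally show ?thesis using 2 by simp
  qed
qed


section \<open>Moments of Brownian increments\<close>

text \<open>
  Fubini for products of functions of one coordinate each: Lebesgue measure on \<open>real ^ 'n\<close> is the
  image of a product measure indexed by the basis vectors.
\<close>

lemma integral_lborel_vec_prod:
  fixes f :: "'n::finite \<Rightarrow> real \<Rightarrow> real"
  assumes f: "\<And>i. integrable lborel (f i)"
  shows "integrable lborel (\<lambda>x::real ^ 'n. \<Prod>i\<in>UNIV. f i (x $ i))" (is ?I)
    and "(LINT x|lborel. (\<Prod>i\<in>UNIV. f i ((x :: real ^ 'n) $ i))) = (\<Prod>i\<in>UNIV. (LINT y|lborel. f i y))" (is ?E)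
proof -
  interpret product_sigma_finite "\<lambda>b :: real ^ 'n. lborel :: real measure" ..
  have [measurable]: "f i \<in> borel_measurable borel" for i
    using borel_measurable_integrable[OF f[of i]] by simp
  define ax :: "'n \<Rightarrow> real ^ 'n" where "ax = (\<lambda>i. axis i 1)"
  have inj: "inj ax" by (auto simp: ax_def inj_def axis_eq_axis)
  have Basis: "(Basis :: (real ^ 'n) set) = range ax"
    by (auto simp: Basis_vec_def ax_def)
  have nth: "(\<Sum>b\<in>Basis. y b *\<^sub>R b) $ i = y (ax i)" for y :: "real ^ 'n \<Rightarrow> real" and i
  proof -
    have "(\<Sum>b\<in>Basis. y b *\<^sub>R b) $ i = (\<Sum>b\<in>Basis. y b *\<^sub>R b) \<bullet> ax i"
      by (simp add: ax_def inner_axis)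
    also have "\<dots> = y (ax i)" by (rule inner_sum_left_Basis) (auto simp: Basis)
    finally show ?thesis .
  qed
  have prod_eq: "(\<Prod>b\<in>Basis. g (inv ax b) b) = (\<Prod>i\<in>UNIV. g i (ax i))" for g :: "'n \<Rightarrow> real ^ 'n \<Rightarrow> real"
    unfolding Basis by (subst prod.reindex[OF inj]) (simp add: inv_f_f[OF inj])
  have eq: "(\<Prod>i\<in>UNIV. f i ((\<Sum>b\<in>Basis. y b *\<^sub>R b) $ i)) = (\<Prod>b\<in>Basis. f (inv ax b) (y b))"
    for y :: "real ^ 'n \<Rightarrow> real"
    unfolding nth prod_eq[of "\<lambda>i b. f i (y b)"] ..
  have int: "integrable (\<Pi>\<^sub>M b\<in>(Basis :: (real ^ 'n) set). lborel) (\<lambda>y. \<Prod>b\<in>Basis. f (inv ax b) (y b))"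
    by (rule product_integrable_prod) (auto simp: f)
  show ?I
    by (subst lborel_eq, subst integrable_distr_eq) (measurable, simp only: eq int)
  have "(LINT x|lborel. (\<Prod>i\<in>UNIV. f i ((x :: real ^ 'n) $ i)))
      = (LINT y|(\<Pi>\<^sub>M b\<in>(Basis :: (real ^ 'n) set). lborel). (\<Prod>b\<in>Basis. f (inv ax b) (y b)))"
    by (subst lborel_eq, subst integral_distr) (measurable, simp only: eq)
  also have "\<dots> = (\<Prod>b\<in>(Basis :: (real ^ 'n) set). (LINT y|lborel. f (inv ax b) y))"
    by (rule product_integral_prod) (auto simp: f)
  also have "\<dots> = (\<Prod>i\<in>UNIV. (LINT y|lborel. f i y))"
    by (rule prod_eq)
  finally show ?E .
qed

lemma brownian_increment_distributed:
  assumes "brownian_motion M B" "0 \<le> s" "s < t"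
  shows "distributed M lborel (\<lambda>\<omega>. B t \<omega> - B s \<omega>)
          (\<lambda>x. ennreal (\<Prod>i\<in>UNIV. normal_density 0 (sqrt (t - s)) (x $ i)))"
  using assms by (auto simp: brownian_motion_def)

lemma brownian_increment_integral_prod:
  fixes g :: "'n::finite \<Rightarrow> real \<Rightarrow> real" and B :: "real \<Rightarrow> 'a \<Rightarrow> real ^ 'n"
  assumes B: "brownian_motion M B" and st: "0 \<le> s" "s < t"
    and g [measurable]: "\<And>i. g i \<in> borel_measurable borel"
    and int: "\<And>i. integrable lborel (\<lambda>y. normal_density 0 (sqrt (t - s)) y * g i y)"
  shows "integrable M (\<lambda>\<omega>. \<Prod>i\<in>UNIV. g i ((B t \<omega> - B s \<omega>) $ i))"
    and "(LINT \<omega>|M. (\<Prod>i\<in>UNIV. g i ((B t \<omega> - B s \<omega>) $ i)))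
       = (\<Prod>i\<in>UNIV. (LINT y|lborel. normal_density 0 (sqrt (t - s)) y * g i y))"
proof -
  let ?d = "\<lambda>x :: real ^ 'n. \<Prod>i\<in>UNIV. normal_density 0 (sqrt (t - s)) (x $ i)"
  have D: "distributed M lborel (\<lambda>\<omega>. B t \<omega> - B s \<omega>) ?d"
    using brownian_increment_distributed[OF B st] .
  have m: "(\<lambda>x :: real ^ 'n. \<Prod>i\<in>UNIV. g i (x $ i)) \<in> borel_measurable lborel" by measurable
  have nn: "0 \<le> ?d x" for x by (intro prod_nonneg) auto
  have eq: "?d x * (\<Prod>i\<in>UNIV. g i (x $ i)) = (\<Prod>i\<in>UNIV. normal_density 0 (sqrt (t - s)) (x $ i) * g i (x $ i))" for x
    by (simp add: prod.distrib)
  show "integrable M (\<lambda>\<omega>. \<Prod>i\<in>UNIV. g i ((B t \<omega> - B s \<omega>) $ i))"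
    using distributed_integrable[OF D m nn] integral_lborel_vec_prod(1)[of "\<lambda>i y. normal_density 0 (sqrt (t - s)) y * g i y", OF int] by (simp add: eq)
  show "(LINT \<omega>|M. (\<Prod>i\<in>UNIV. g i ((B t \<omega> - B s \<omega>) $ i)))
       = (\<Prod>i\<in>UNIV. (LINT y|lborel. normal_density 0 (sqrt (t - s)) y * g i y))"
    using distributed_integral[OF D m nn] integral_lborel_vec_prod(2)[of "\<lambda>i y. normal_density 0 (sqrt (t - s)) y * g i y", OF int] by (simp add: eq)
qed

text \<open>
  Distinct coordinates of an increment are independent and centred. No coordinate is repeated in
  the product, and this is why a polynomial that is affine in each variable picks up no
  second-order correction.
\<close>

lemma brownian_increment_prod_mean_zero:
  fixes B :: "real \<Rightarrow> 'a \<Rightarrow> real ^ 'n::finite"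
  assumes B: "brownian_motion M B" and st: "0 \<le> s" "s < t"
  shows "integrable M (\<lambda>\<omega>. \<Prod>i\<in>T. (B t \<omega> - B s \<omega>) $ i)"
    and "T \<noteq> {} \<Longrightarrow> (LINT \<omega>|M. (\<Prod>i\<in>T. (B t \<omega> - B s \<omega>) $ i)) = 0"
proof -
  define g :: "'n \<Rightarrow> real \<Rightarrow> real" where "g = (\<lambda>i y. if i \<in> T then y else 1)"
  have pos: "sqrt (t - s) > 0" using st by simp
  have g: "g i \<in> borel_measurable borel" for i by (auto simp: g_def)
  have int: "integrable lborel (\<lambda>y. normal_density 0 (sqrt (t - s)) y * g i y)" for i
    using integrable_normal_moment_nz_1[OF pos, of 0] integrable_normal_density[OF pos, of 0]
    by (cases "i \<in> T") (auto simp: g_def)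
  have eq: "(\<Prod>i\<in>UNIV. g i (x $ i)) = (\<Prod>i\<in>T. x $ i)" for x :: "real ^ 'n"
    by (simp add: g_def prod.If_cases)
  show "integrable M (\<lambda>\<omega>. \<Prod>i\<in>T. (B t \<omega> - B s \<omega>) $ i)"
    using brownian_increment_integral_prod(1)[of M B s t g, OF B st g int] unfolding eq .
  assume "T \<noteq> {}"
  then obtain i where i: "i \<in> T" by auto
  have "(LINT y|lborel. normal_density 0 (sqrt (t - s)) y * g i y) = 0"
    using i integral_normal_moment_nz_1[OF pos, of 0] by (simp add: g_def)
  then have "(\<Prod>i\<in>UNIV. (LINT y|lborel. normal_density 0 (sqrt (t - s)) y * g i y)) = 0"
    by (intro prod_zero) auto
  then show "(LINT \<omega>|M. (\<Prod>i\<in>T. (B t \<omega> - B s \<omega>) $ i)) = 0"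
    using brownian_increment_integral_prod(2)[of M B s t g, OF B st g int] unfolding eq by simp
qed

lemma norm_vec_power_le:
  fixes x :: "real ^ 'n::finite"
  shows "norm x ^ p \<le> real CARD('n) ^ p * (\<Sum>i\<in>UNIV. \<bar>x $ i\<bar> ^ p)"
proof -
  define m where "m = Max (range (\<lambda>i. \<bar>x $ i\<bar>))"
  have "m \<in> range (\<lambda>i. \<bar>x $ i\<bar>)" unfolding m_def by (rule Max_in) auto
  then obtain j where j: "m = \<bar>x $ j\<bar>" by auto
  have "\<bar>x $ i\<bar> \<le> m" for i unfolding m_def by (rule Max_ge) auto
  then have "(\<Sum>i\<in>UNIV. \<bar>x $ i\<bar>) \<le> real CARD('n) * m"
    by (intro sum_bounded_above) auto
  then have "norm x \<le> real CARD('n) * m" using norm_le_l1_cart[of x] by linarith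
  then have "norm x ^ p \<le> (real CARD('n) * m) ^ p" by (intro power_mono) auto
  also have "\<dots> = real CARD('n) ^ p * \<bar>x $ j\<bar> ^ p" by (simp add: power_mult_distrib j)
  also have "\<dots> \<le> real CARD('n) ^ p * (\<Sum>i\<in>UNIV. \<bar>x $ i\<bar> ^ p)"
    by (intro mult_left_mono member_le_sum) auto
  finally show ?thesis .
qed

text \<open>
  Brownian scaling. The order \<open>2 * q\<close> stays arbitrary because the polynomial growth of the test
  function and the union bound over a dyadic grid both consume powers.
\<close>

lemma brownian_increment_moment:
  fixes B :: "real \<Rightarrow> 'a \<Rightarrow> real ^ 'n::finite"
  assumes B: "brownian_motion M B"
  obtains C where "C \<ge> 0" "\<And>s t. 0 \<le> s \<Longrightarrow> s < t \<Longrightarrow> integrable M (\<lambda>\<omega>. norm (B t \<omega> - B s \<omega>) ^ (2 * q))"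
    "\<And>s t. 0 \<le> s \<Longrightarrow> s < t \<Longrightarrow> (LINT \<omega>|M. norm (B t \<omega> - B s \<omega>) ^ (2 * q)) \<le> C * (t - s) ^ q"
proof
  define c :: real where "c = fact (2 * q) / (2 ^ q * fact q)"
  define C where "C = real CARD('n) ^ (2 * q) * (real CARD('n) * c)"
  show "C \<ge> 0" by (simp add: C_def c_def)
  fix s t :: real assume st: "0 \<le> s" "s < t"
  have pos: "sqrt (t - s) > 0" using st by simp
  have [measurable]: "B r \<in> borel_measurable M" if "r \<ge> 0" for r
    using B that by (auto simp: brownian_motion_def)
  have [measurable]: "B s \<in> borel_measurable M" "B t \<in> borel_measurable M" using st by auto
  have coord: "integrable M (\<lambda>\<omega>. (B t \<omega> - B s \<omega>) $ i ^ (2 * q)) \<and>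
      (LINT \<omega>|M. (B t \<omega> - B s \<omega>) $ i ^ (2 * q)) = c * (t - s) ^ q" for i
  proof -
    define g :: "'n \<Rightarrow> real \<Rightarrow> real" where "g = (\<lambda>j y. if j = i then y ^ (2 * q) else 1)"
    have g: "g j \<in> borel_measurable borel" for j by (auto simp: g_def)
    have int: "integrable lborel (\<lambda>y. normal_density 0 (sqrt (t - s)) y * g j y)" for j
      using integrable_normal_moment[OF pos, of 0 "2 * q"] integrable_normal_density[OF pos, of 0]
      by (cases "j = i") (auto simp: g_def)
    have eq: "(\<Prod>j\<in>UNIV. g j (x $ j)) = x $ i ^ (2 * q)" for x :: "real ^ 'n"
      by (simp add: g_def prod.delta)
    have "(LINT y|lborel. normal_density 0 (sqrt (t - s)) y * g j y) = (if j = i then c * (t - s) ^ q else 1)" for j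
      using integral_normal_moment_even[OF pos, of 0 q] integral_normal_density[OF pos, of 0] st
      by (auto simp: g_def c_def power_divide)
    then have "(\<Prod>j\<in>UNIV. (LINT y|lborel. normal_density 0 (sqrt (t - s)) y * g j y)) = c * (t - s) ^ q"
      by (simp add: prod.delta)
    then show ?thesis
      using brownian_increment_integral_prod[of M B s t g, OF B st g int] unfolding eq by simp
  qed
  have le: "norm (B t \<omega> - B s \<omega>) ^ (2 * q) \<le> real CARD('n) ^ (2 * q) * (\<Sum>i\<in>UNIV. (B t \<omega> - B s \<omega>) $ i ^ (2 * q))" for \<omega>
    using norm_vec_power_le[of "B t \<omega> - B s \<omega>" "2 * q"] by (simp add: power_even_abs)
  have int: "integrable M (\<lambda>\<omega>. real CARD('n) ^ (2 * q) * (\<Sum>i\<in>UNIV. (B t \<omega> - B s \<omega>) $ i ^ (2 * q)))"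
    by (intro integrable_mult_right Bochner_Integration.integrable_sum conjunct1[OF coord])
  show int2: "integrable M (\<lambda>\<omega>. norm (B t \<omega> - B s \<omega>) ^ (2 * q))"
  proof (rule Bochner_Integration.integrable_bound[OF int])
    show "AE \<omega> in M. norm (norm (B t \<omega> - B s \<omega>) ^ (2 * q))
      \<le> norm (real CARD('n) ^ (2 * q) * (\<Sum>i\<in>UNIV. (B t \<omega> - B s \<omega>) $ i ^ (2 * q)))"
      using order.trans[OF le abs_ge_self] by (intro AE_I2) (simp add: del: abs_mult)
  qed measurable
  have "(LINT \<omega>|M. norm (B t \<omega> - B s \<omega>) ^ (2 * q))
      \<le> (LINT \<omega>|M. real CARD('n) ^ (2 * q) * (\<Sum>i\<in>UNIV. (B t \<omega> - B s \<omega>) $ i ^ (2 * q)))"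
    by (intro integral_mono int int2 le)
  also have "\<dots> = C * (t - s) ^ q"
    by (simp only: integral_mult_right_zero Bochner_Integration.integral_sum[OF conjunct1[OF coord]]
        conjunct2[OF coord] sum_constant C_def mult.assoc order_refl)
  finally show "(LINT \<omega>|M. norm (B t \<omega> - B s \<omega>) ^ (2 * q)) \<le> C * (t - s) ^ q" .
qed


section \<open>A chain rule along paths of finite variation\<close>

text \<open>
  The grid that cuts \<open>[s, t]\<close> into \<open>Suc n\<close> equal cells; there is at least one cell for each \<open>n\<close>.
\<close>

definition mesh :: "real \<Rightarrow> real \<Rightarrow> nat \<Rightarrow> nat \<Rightarrow> real" where
  "mesh s t n j = s + (t - s) * real j / real (Suc n)"

lemma mesh_0 [simp]: "mesh s t n 0 = s" and mesh_Suc_n [simp]: "mesh s t n (Suc n) = t"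
  by (simp_all add: mesh_def del: of_nat_Suc)

lemma mesh_mono: "s \<le> t \<Longrightarrow> j \<le> j' \<Longrightarrow> mesh s t n j \<le> mesh s t n j'"
  unfolding mesh_def by (intro add_left_mono divide_right_mono mult_left_mono) auto

lemma mesh_bounds:
  assumes "s \<le> t" "j \<le> Suc n" shows "s \<le> mesh s t n j" "mesh s t n j \<le> t"
  using mesh_mono[OF assms(1), of 0 j n] mesh_mono[OF assms, of n] by simp_all

lemma mesh_step: "mesh s t n (Suc j) - mesh s t n j = (t - s) / real (Suc n)"
proof -
  have "mesh s t n (Suc j) - mesh s t n j = ((t - s) * real (Suc j) - (t - s) * real j) / real (Suc n)"
    by (simp add: mesh_def diff_divide_distrib del: of_nat_Suc)
  also have "(t - s) * real (Suc j) - (t - s) * real j = t - s" by (simp add: algebra_simps)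
  finally show ?thesis .
qed

lemma mesh_cell:
  assumes "s < u" "u \<le> t"
  obtains j where "j \<le> n" "u \<in> {mesh s t n j <.. mesh s t n (Suc j)}"
proof -
  define j where "j = (LEAST j. u \<le> mesh s t n (Suc j))"
  have ex: "u \<le> mesh s t n (Suc n)" using assms by simp
  have 1: "u \<le> mesh s t n (Suc j)" unfolding j_def by (rule LeastI[where P = "\<lambda>j. u \<le> mesh s t n (Suc j)", OF ex])
  have 2: "j \<le> n" unfolding j_def by (rule Least_le[where P = "\<lambda>j. u \<le> mesh s t n (Suc j)", OF ex])
  have 3: "mesh s t n j < u"
  proof (cases j)
    case 0 then show ?thesis using assms by simp
  next
    case (Suc i)
    then have "\<not> u \<le> mesh s t n (Suc i)" unfolding j_def using not_less_Least[of i "\<lambda>j. u \<le> mesh s t n (Suc j)"]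
      by (simp add: j_def[symmetric])
    then show ?thesis using Suc by simp
  qed
  show thesis using that[of j] 1 2 3 by auto
qed

lemma mesh_cell_unique:
  assumes "s \<le> t" "u \<in> {mesh s t n i <.. mesh s t n (Suc i)}" "u \<in> {mesh s t n j <.. mesh s t n (Suc j)}"
  shows "i = j"
proof (rule ccontr)
  assume "i \<noteq> j"
  then consider "Suc i \<le> j" | "Suc j \<le> i" by linarith
  then show False
    using assms(2,3) mesh_mono[OF assms(1), of "Suc i" j n] mesh_mono[OF assms(1), of "Suc j" i n]
    by cases auto
qed

text \<open>
  A step function takes on each cell the value attached to that cell. Half-open cells make
  the cell unique.
\<close>

lemma sum_mesh_indicator:
  fixes f :: "nat \<Rightarrow> 'b::real_vector"
  assumes "s \<le> t" "j \<le> n" "u \<in> {mesh s t n j <.. mesh s t n (Suc j)}"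
  shows "(\<Sum>i\<le>n. indicator {mesh s t n i <.. mesh s t n (Suc i)} u *\<^sub>R f i) = f j"
proof -
  have "(\<Sum>i\<le>n. indicator {mesh s t n i <.. mesh s t n (Suc i)} u *\<^sub>R f i) = (\<Sum>i\<le>n. if i = j then f i else 0)"
  proof (intro sum.cong refl)
    fix i
    show "indicator {mesh s t n i <.. mesh s t n (Suc i)} u *\<^sub>R f i = (if i = j then f i else 0)"
    proof (cases "i = j")
      case True
      then show ?thesis using assms(3) by simp
    next
      case False
      then have "u \<notin> {mesh s t n i <.. mesh s t n (Suc i)}"
        using mesh_cell_unique[OF assms(1) _ assms(3), of i] by blast
      then show ?thesis using False by simp
    qed
  qed
  then show ?thesis using assms(2) by simp
qed

locale smooth_function =
  fixes F :: "'v::euclidean_space \<Rightarrow> real" and gF :: "'v \<Rightarrow> 'v"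
  assumes deriv: "(F has_derivative (\<lambda>h. gF z \<bullet> h)) (at z)"
    and cont_gF: "continuous_on UNIV gF"
begin

lemma mean_value:
  obtains \<xi> where "\<xi> \<in> closed_segment z z'" "F z' - F z = gF \<xi> \<bullet> (z' - z)"
proof -
  have "\<exists>\<theta>\<in>{0<..<1}. F (z + 1 *\<^sub>R (z' - z)) - F (z + 0 *\<^sub>R (z' - z)) = (1 - 0) * (gF (z + \<theta> *\<^sub>R (z' - z)) \<bullet> (z' - z))"
  proof -
    have "((\<lambda>\<theta>. F (z + \<theta> *\<^sub>R (z' - z))) has_real_derivative gF (z + \<theta> *\<^sub>R (z' - z)) \<bullet> (z' - z)) (at \<theta>)" for \<theta>
    proof -
      have "((\<lambda>\<theta>. F (z + \<theta> *\<^sub>R (z' - z))) has_derivative (\<lambda>h. gF (z + \<theta> *\<^sub>R (z' - z)) \<bullet> (h *\<^sub>R (z' - z)))) (at \<theta>)"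
        by (rule has_derivative_compose[OF _ deriv]) (auto intro!: derivative_eq_intros)
      then show ?thesis by (simp add: has_field_derivative_def mult.commute[of _ "_ \<bullet> _"] mult_commute_abs)
    qed
    from MVT2[of 0 1 "\<lambda>\<theta>. F (z + \<theta> *\<^sub>R (z' - z))", OF _ this] show ?thesis by auto
  qed
  then obtain \<theta> where \<theta>: "0 < \<theta>" "\<theta> < 1" "F z' - F z = gF (z + \<theta> *\<^sub>R (z' - z)) \<bullet> (z' - z)" by auto
  have "z + \<theta> *\<^sub>R (z' - z) \<in> closed_segment z z'"
    unfolding in_segment using \<theta> by (intro exI[of _ \<theta>]) (auto simp: algebra_simps)
  with \<theta> that show thesis by blast
qed

end

text \<open>
  A path \<open>v + w\<close> whose part \<open>v\<close> is absolutely continuous with density \<open>d\<close>, while \<open>w\<close> is merely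
  continuous; \<open>w\<close> stands for a Brownian path.
\<close>

locale finite_variation_path = smooth_function F gF
  for F :: "'v::euclidean_space \<Rightarrow> real" and gF +
  fixes v w d :: "real \<Rightarrow> 'v" and s t :: real
  assumes st: "s \<le> t"
    and d_int: "set_integrable lborel {s..t} d"
    and v_diff: "s \<le> a \<Longrightarrow> a \<le> b \<Longrightarrow> b \<le> t \<Longrightarrow> v b - v a = (LBINT r:{a<..b}. d r)"
    and cont_v: "continuous_on {s..t} v" and cont_w: "continuous_on {s..t} w"
begin

text \<open>
  The increments of \<open>F\<close> that are caused by \<open>v\<close> alone: across each cell the rough part is frozen at
  its value at the right end. What is left out are the increments of \<open>F\<close> due to \<open>w\<close> with \<open>v\<close> at
  its left end; for the polynomials considered below, those have conditional mean zero.
\<close>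

definition riemann_sum :: "nat \<Rightarrow> real" where
  "riemann_sum n = (\<Sum>j\<le>n. F (v (mesh s t n (Suc j)) + w (mesh s t n (Suc j)))
                       - F (v (mesh s t n j) + w (mesh s t n (Suc j))))"

text \<open>
  The points at which the mean value theorem may evaluate the gradient on a cell.
\<close>

definition cell_segment :: "nat \<Rightarrow> nat \<Rightarrow> 'v set" where
  "cell_segment n j = closed_segment (v (mesh s t n j) + w (mesh s t n (Suc j)))
                        (v (mesh s t n (Suc j)) + w (mesh s t n (Suc j)))"

definition cell_gradient :: "nat \<Rightarrow> (nat \<Rightarrow> 'v) \<Rightarrow> real \<Rightarrow> 'v" where
  "cell_gradient n \<xi> r = (\<Sum>j\<le>n. indicator {mesh s t n j <.. mesh s t n (Suc j)} r *\<^sub>R gF (\<xi> j))"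

text \<open>
  The mean value theorem on each cell turns the sum into a single integral of \<open>d\<close> against a step
  function, which is the form to which dominated convergence applies.
\<close>

lemma riemann_sum_eq:
  "\<exists>\<xi>. (\<forall>j. \<xi> j \<in> cell_segment n j) \<and>
    riemann_sum n = (LBINT r:{s..t}. cell_gradient n \<xi> r \<bullet> d r)"
proof -
  let ?p = "mesh s t n"
  have "\<exists>\<xi>. \<xi> \<in> cell_segment n j
     \<and> F (v (?p (Suc j)) + w (?p (Suc j))) - F (v (?p j) + w (?p (Suc j))) = gF \<xi> \<bullet> (v (?p (Suc j)) - v (?p j))" for j
    by (rule mean_value[of "v (?p j) + w (?p (Suc j))" "v (?p (Suc j)) + w (?p (Suc j))"]) (auto simp: cell_segment_def)
  then obtain \<xi> where \<xi>: "\<And>j. \<xi> j \<in> cell_segment n j"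
     "\<And>j. F (v (?p (Suc j)) + w (?p (Suc j))) - F (v (?p j) + w (?p (Suc j))) = gF (\<xi> j) \<bullet> (v (?p (Suc j)) - v (?p j))"
    by metis
  have sub: "{?p j <.. ?p (Suc j)} \<subseteq> {s..t}" if "j \<le> n" for j
    using that mesh_bounds[OF st, of j n] mesh_bounds[OF st, of "Suc j" n] by auto
  have int: "set_integrable lborel {?p j <.. ?p (Suc j)} d" if "j \<le> n" for j
    using set_integrable_subset[OF d_int _ sub[OF that]] by simp
  have "riemann_sum n = (\<Sum>j\<le>n. gF (\<xi> j) \<bullet> (LBINT r:{?p j <.. ?p (Suc j)}. d r))"
    unfolding riemann_sum_def
  proof (intro sum.cong refl)
    fix j assume "j \<in> {..n}"
    then have "v (?p (Suc j)) - v (?p j) = (LBINT r:{?p j <.. ?p (Suc j)}. d r)"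
      using mesh_bounds[OF st, of j n] mesh_bounds[OF st, of "Suc j" n] mesh_mono[OF st, of j "Suc j" n]
      by (intro v_diff) auto
    then show "F (v (?p (Suc j)) + w (?p (Suc j))) - F (v (?p j) + w (?p (Suc j))) = gF (\<xi> j) \<bullet> (LBINT r:{?p j <.. ?p (Suc j)}. d r)"
      using \<xi>(2)[of j] by simp
  qed
  also have "\<dots> = (\<Sum>j\<le>n. LINT r|lborel. gF (\<xi> j) \<bullet> (indicator {?p j <.. ?p (Suc j)} r *\<^sub>R d r))"
    unfolding set_lebesgue_integral_def
    using int by (intro sum.cong refl integral_inner_right[symmetric]) (auto simp: set_integrable_def)
  also have "\<dots> = (LINT r|lborel. (\<Sum>j\<le>n. gF (\<xi> j) \<bullet> (indicator {?p j <.. ?p (Suc j)} r *\<^sub>R d r)))"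
    using int unfolding set_integrable_def
    by (intro Bochner_Integration.integral_sum[symmetric] integrable_inner_right) auto
  also have "\<dots> = (LBINT r:{s..t}. cell_gradient n \<xi> r \<bullet> d r)"
    unfolding set_lebesgue_integral_def
  proof (intro Bochner_Integration.integral_cong refl)
    fix r :: real
    show "(\<Sum>j\<le>n. gF (\<xi> j) \<bullet> (indicator {?p j <.. ?p (Suc j)} r *\<^sub>R d r))
      = indicator {s..t} r *\<^sub>R (cell_gradient n \<xi> r \<bullet> d r)"
      unfolding cell_gradient_def inner_sum_left real_scaleR_def sum_distrib_left
      using sub[THEN subsetD, of _ r] by (intro sum.cong refl) (auto simp: indicator_def)
  qed
  finally show ?thesis using \<xi>(1) by blast
qed

lemma segment_point_bound:
  assumes R: "\<And>r. r \<in> {s..t} \<Longrightarrow> norm (v r) + norm (w r) \<le> R"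
    and "j \<le> n"
    and "\<xi> \<in> cell_segment n j"
  shows "norm \<xi> \<le> 2 * R"
proof -
  have m: "mesh s t n j \<in> {s..t}" "mesh s t n (Suc j) \<in> {s..t}"
    using mesh_bounds[OF st, of j n] mesh_bounds[OF st, of "Suc j" n] \<open>j \<le> n\<close> by auto
  have "norm (v (mesh s t n j)) \<le> R" "norm (v (mesh s t n (Suc j))) \<le> R" "norm (w (mesh s t n (Suc j))) \<le> R"
    using R[OF m(1)] R[OF m(2)] norm_ge_zero[of "w (mesh s t n j)"] norm_ge_zero[of "w (mesh s t n (Suc j))"]
      norm_ge_zero[of "v (mesh s t n (Suc j))"] by linarith+
  then have "v (mesh s t n j) + w (mesh s t n (Suc j)) \<in> cball 0 (2 * R)"
     "v (mesh s t n (Suc j)) + w (mesh s t n (Suc j)) \<in> cball 0 (2 * R)"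
    by (auto intro: order.trans[OF norm_triangle_ineq])
  then have "cell_segment n j \<subseteq> cball 0 (2 * R)"
    unfolding cell_segment_def by (intro closed_segment_subset) auto
  then show ?thesis using assms(3) by auto
qed

lemma bound_nonneg:
  assumes R: "\<And>r. r \<in> {s..t} \<Longrightarrow> norm (v r) + norm (w r) \<le> R"
    and K: "\<And>z. norm z \<le> 2 * R \<Longrightarrow> norm (gF z) \<le> K"
  shows "0 \<le> K"
proof -
  have "norm (v s) + norm (w s) \<le> R" using R[of s] st by simp
  then have "0 \<le> R" by (rule order.trans[rotated]) simp
  then have "norm (0::'v) \<le> 2 * R" by simp
  then show ?thesis using K[of 0] norm_ge_zero[of "gF 0"] by linarith
qed

lemma simple_integrand_bound:
  assumes R: "\<And>r. r \<in> {s..t} \<Longrightarrow> norm (v r) + norm (w r) \<le> R"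
    and K: "\<And>z. norm z \<le> 2 * R \<Longrightarrow> norm (gF z) \<le> K"
    and \<xi>: "\<And>j. \<xi> j \<in> cell_segment n j"
  shows "\<bar>cell_gradient n \<xi> r \<bullet> e\<bar> \<le> K * norm e"
proof -
  have "0 \<le> K" by (rule bound_nonneg[OF R K])
  have "norm (cell_gradient n \<xi> r) \<le> K"
  proof (cases "\<exists>j\<le>n. r \<in> {mesh s t n j <.. mesh s t n (Suc j)}")
    case True
    then obtain j where j: "j \<le> n" "r \<in> {mesh s t n j <.. mesh s t n (Suc j)}" by auto
    show ?thesis unfolding cell_gradient_def using sum_mesh_indicator[OF st j, of "\<lambda>j. gF (\<xi> j)"]
      K[OF segment_point_bound[OF R j(1) \<xi>[of j]]] by simp
  next
    case False
    then have "cell_gradient n \<xi> r = 0"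
      unfolding cell_gradient_def by (intro sum.neutral) (auto simp: indicator_def)
    then show ?thesis using \<open>K \<ge> 0\<close> by simp
  qed
  then show ?thesis
    using Cauchy_Schwarz_ineq2[of "cell_gradient n \<xi> r" e]
    by (meson mult_right_mono norm_ge_zero order.trans)
qed

text \<open>
  A bound uniform in \<open>n\<close>; it supplies the dominating random variable later on. The radius
  \<open>2 * R\<close> appears because \<open>v\<close> and \<open>w\<close> are evaluated at different times.
\<close>

lemma riemann_sum_bound:
  assumes R: "\<And>r. r \<in> {s..t} \<Longrightarrow> norm (v r) + norm (w r) \<le> R"
    and K: "\<And>z. norm z \<le> 2 * R \<Longrightarrow> norm (gF z) \<le> K"
  shows "\<bar>riemann_sum n\<bar> \<le> K * (LBINT r:{s..t}. norm (d r))"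
proof -
  obtain \<xi> where "(\<forall>j. \<xi> j \<in> cell_segment n j) \<and>
    riemann_sum n = (LBINT r:{s..t}. cell_gradient n \<xi> r \<bullet> d r)"
    using riemann_sum_eq[of n] ..
  note \<xi> = this[THEN conjunct1, THEN spec] this[THEN conjunct2]
  have dn: "set_integrable lborel {s..t} (\<lambda>r. norm (d r))"
    using d_int by (rule set_integrable_norm)
  have "\<bar>riemann_sum n\<bar> \<le> (LINT r|lborel. K * (indicator {s..t} r *\<^sub>R norm (d r)))"
    unfolding \<xi>(2) set_lebesgue_integral_def
  proof (rule integral_abs_bound[THEN order.trans], rule integral_mono')
    show "integrable lborel (\<lambda>r. K * (indicator {s..t} r *\<^sub>R norm (d r)))"
      using dn unfolding set_integrable_def by (rule integrable_mult_right)
    show "\<bar>indicator {s..t} r *\<^sub>R (cell_gradient n \<xi> r \<bullet> d r)\<bar>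
        \<le> K * (indicator {s..t} r *\<^sub>R norm (d r))" for r
      using simple_integrand_bound[OF R K \<xi>(1), of r "d r"] by (auto simp: indicator_def)
  qed (use bound_nonneg[OF R K] in auto)
  also have "\<dots> = K * (LBINT r:{s..t}. norm (d r))"
    unfolding set_lebesgue_integral_def by simp
  finally show ?thesis .
qed

lemma path_bounded: obtains R where "\<And>r. r \<in> {s..t} \<Longrightarrow> norm (v r) + norm (w r) \<le> R"
proof -
  have "compact ((\<lambda>r. norm (v r) + norm (w r)) ` {s..t})"
    by (intro compact_continuous_image continuous_intros cont_v cont_w) auto
  then have "bounded ((\<lambda>r. norm (v r) + norm (w r)) ` {s..t})" by (rule compact_imp_bounded)
  then obtain R where "\<And>y. y \<in> (\<lambda>r. norm (v r) + norm (w r)) ` {s..t} \<Longrightarrow> norm y \<le> R"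
    unfolding bounded_iff by blast
  then show thesis by (intro that[of R]) force
qed

lemma gradient_bounded: obtains K where "\<And>z. norm z \<le> R \<Longrightarrow> norm (gF z) \<le> K"
proof -
  have "compact (gF ` cball 0 R)"
    by (intro compact_continuous_image continuous_on_subset[OF cont_gF]) auto
  then have "bounded (gF ` cball 0 R)" by (rule compact_imp_bounded)
  then obtain K where "\<And>y. y \<in> gF ` cball 0 R \<Longrightarrow> norm y \<le> K" unfolding bounded_iff by blast
  then show thesis by (intro that[of K]) auto
qed

text \<open>
  Both ends of the shrinking cells around \<open>u\<close> tend to \<open>u\<close>, and \<open>v\<close>, \<open>w\<close> are continuous, so freezing
  \<open>w\<close> at the wrong time makes no difference in the limit.
\<close>

lemma segment_point_converges:
  assumes u: "s < u" "u \<le> t"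
    and j: "\<And>n. j n \<le> n" "\<And>n. u \<in> {mesh s t n (j n) <.. mesh s t n (Suc (j n))}"
    and \<xi>: "\<And>n. \<xi> n \<in> cell_segment n (j n)"
  shows "\<xi> \<longlonglongrightarrow> v u + w u"
proof -
  let ?l = "\<lambda>n. mesh s t n (j n)" and ?r = "\<lambda>n. mesh s t n (Suc (j n))"
  have in': "?l n \<in> {s..t}" "?r n \<in> {s..t}" for n
    using mesh_bounds[OF st, of "j n" n] mesh_bounds[OF st, of "Suc (j n)" n] j(1)[of n] by auto
  have step: "(\<lambda>n. (t - s) / real (Suc n)) \<longlonglongrightarrow> 0"
    using LIMSEQ_Suc[OF lim_const_over_n[of "t - s"]] by simp
  have near: "\<bar>?l n - u\<bar> \<le> (t - s) / real (Suc n)" "\<bar>?r n - u\<bar> \<le> (t - s) / real (Suc n)" for n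
    using mesh_step[of s t n "j n"] j(2)[of n] by (auto simp del: of_nat_Suc)
  have l: "?l \<longlonglongrightarrow> u" and r: "?r \<longlonglongrightarrow> u"
    by (rule Lim_null_comparison[OF _ step, THEN Lim_null[THEN iffD2]], use near in auto)+
  have u': "u \<in> {s..t}" using u by auto
  have lim: "(\<lambda>n. v (?l n) + w (?r n)) \<longlonglongrightarrow> v u + w u" "(\<lambda>n. v (?r n) + w (?r n)) \<longlonglongrightarrow> v u + w u"
    using continuous_on_tendsto_compose[OF cont_v l u'] continuous_on_tendsto_compose[OF cont_v r u']
      continuous_on_tendsto_compose[OF cont_w r u'] in' by (auto intro!: tendsto_add)
  have bound: "norm (\<xi> n - (v u + w u)) \<le> norm (v (?l n) + w (?r n) - (v u + w u)) + norm (v (?r n) + w (?r n) - (v u + w u))" for n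
  proof -
    let ?c = "v u + w u"
    have "closed_segment (v (?l n) + w (?r n)) (v (?r n) + w (?r n))
       \<subseteq> cball ?c (norm (v (?l n) + w (?r n) - ?c) + norm (v (?r n) + w (?r n) - ?c))"
      by (intro closed_segment_subset) (auto simp: dist_norm norm_minus_commute)
    then have "\<xi> n \<in> cball ?c (norm (v (?l n) + w (?r n) - ?c) + norm (v (?r n) + w (?r n) - ?c))"
      using \<xi>[of n] unfolding cell_segment_def by (rule subsetD)
    then show ?thesis by (simp add: dist_norm norm_minus_commute)
  qed
  have "(\<lambda>n. norm (v (?l n) + w (?r n) - (v u + w u)) + norm (v (?r n) + w (?r n) - (v u + w u))) \<longlonglongrightarrow> 0"
    by (intro tendsto_add_zero tendsto_norm_zero LIM_zero lim)
  then have "(\<lambda>n. \<xi> n - (v u + w u)) \<longlonglongrightarrow> 0"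
    by (rule Lim_null_comparison[OF always_eventually[OF allI[OF bound]]])
  then show ?thesis by (rule LIM_zero_cancel)
qed

lemma integrable_gradient: "set_integrable lborel {s..t} (\<lambda>r. gF (v r + w r) \<bullet> d r)"
proof -
  have [measurable]: "(\<lambda>r. indicator {s..t} r *\<^sub>R d r) \<in> borel_measurable lborel"
    using d_int by (auto simp: set_integrable_def)
  obtain R where R: "\<And>r. r \<in> {s..t} \<Longrightarrow> norm (v r) + norm (w r) \<le> R" by (rule path_bounded) blast
  obtain K where K: "\<And>z. norm z \<le> R \<Longrightarrow> norm (gF z) \<le> K" by (rule gradient_bounded) blast
  have "continuous_on {s..t} (\<lambda>r. gF (v r + w r))"
    by (intro continuous_on_compose2[OF cont_gF] continuous_intros cont_v cont_w) auto
  then have [measurable]: "(\<lambda>r. indicator {s..t} r *\<^sub>R gF (v r + w r)) \<in> borel_measurable lborel"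
    using borel_measurable_continuous_on_indicator[of "{s..t}" "\<lambda>r. gF (v r + w r)"] by simp
  have dn: "set_integrable lborel {s..t} (\<lambda>r. norm (d r))"
    using d_int by (rule set_integrable_norm)
  have eq: "indicator {s..t} r *\<^sub>R (gF (v r + w r) \<bullet> d r) = (indicator {s..t} r *\<^sub>R gF (v r + w r)) \<bullet> (indicator {s..t} r *\<^sub>R d r)" for r
    by (auto simp: indicator_def)
  show ?thesis unfolding set_integrable_def
  proof (rule Bochner_Integration.integrable_bound)
    show "integrable lborel (\<lambda>r. K * (indicator {s..t} r *\<^sub>R norm (d r)))"
      using dn unfolding set_integrable_def by (rule integrable_mult_right)
    show "(\<lambda>r. indicator {s..t} r *\<^sub>R (gF (v r + w r) \<bullet> d r)) \<in> borel_measurable lborel"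
      unfolding eq by measurable
    show "AE r in lborel. norm (indicator {s..t} r *\<^sub>R (gF (v r + w r) \<bullet> d r)) \<le> norm (K * (indicator {s..t} r *\<^sub>R norm (d r)))"
    proof (intro AE_I2)
      fix r :: real
      show "norm (indicator {s..t} r *\<^sub>R (gF (v r + w r) \<bullet> d r)) \<le> norm (K * (indicator {s..t} r *\<^sub>R norm (d r)))"
      proof (cases "r \<in> {s..t}")
        case True
        have "norm (v r + w r) \<le> R" using R[OF True] norm_triangle_ineq[of "v r" "w r"] by linarith
        then have "norm (gF (v r + w r)) \<le> K" by (rule K)
        then have "\<bar>gF (v r + w r) \<bullet> d r\<bar> \<le> K * norm (d r)"
          by (meson Cauchy_Schwarz_ineq2 mult_right_mono norm_ge_zero order.trans)
        then show ?thesis using True by simp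
      qed simp
    qed
  qed
qed

text \<open>
  The chain rule by dominated convergence: the gradients are bounded on the compact set that contains
  all cell segments, and \<open>d\<close> is integrable.
\<close>

theorem riemann_sum_tendsto:
  "riemann_sum \<longlonglongrightarrow> (LBINT r:{s..t}. gF (v r + w r) \<bullet> d r)"
proof -
  obtain R where R: "\<And>r. r \<in> {s..t} \<Longrightarrow> norm (v r) + norm (w r) \<le> R" by (rule path_bounded) blast
  obtain K where K: "\<And>z. norm z \<le> 2 * R \<Longrightarrow> norm (gF z) \<le> K" by (rule gradient_bounded) blast
  define \<xi> where "\<xi> n = (SOME \<xi>. (\<forall>j. \<xi> j \<in> cell_segment n j) \<and>
     riemann_sum n = (LBINT r:{s..t}. cell_gradient n \<xi> r \<bullet> d r))" for n
  have ex: "(\<forall>j. \<xi> n j \<in> cell_segment n j) \<and>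
     riemann_sum n = (LBINT r:{s..t}. cell_gradient n (\<xi> n) r \<bullet> d r)" for n
    unfolding \<xi>_def by (rule someI_ex[OF riemann_sum_eq])
  note \<xi> = ex[THEN conjunct1, THEN spec] and sum = ex[THEN conjunct2]
  let ?g = "\<lambda>n r. cell_gradient n (\<xi> n) r"
  have [measurable]: "?g n \<in> borel_measurable lborel" for n
    unfolding cell_gradient_def by measurable
  have [measurable]: "(\<lambda>r. indicator {s..t} r *\<^sub>R d r) \<in> borel_measurable lborel"
    using d_int by (auto simp: set_integrable_def)
  have dn: "set_integrable lborel {s..t} (\<lambda>r. norm (d r))"
    using d_int by (rule set_integrable_norm)
  have eq: "indicator {s..t} r *\<^sub>R (?g n r \<bullet> d r) = ?g n r \<bullet> (indicator {s..t} r *\<^sub>R d r)" for n r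
    by simp
  show ?thesis
    unfolding sum[abs_def] set_lebesgue_integral_def
  proof (rule integral_dominated_convergence)
    show "(\<lambda>r. indicator {s..t} r *\<^sub>R (gF (v r + w r) \<bullet> d r)) \<in> borel_measurable lborel"
      using integrable_gradient unfolding set_integrable_def by auto
    show "(\<lambda>r. indicator {s..t} r *\<^sub>R (?g n r \<bullet> d r)) \<in> borel_measurable lborel" for n
      unfolding eq by measurable
    show "integrable lborel (\<lambda>r. K * (indicator {s..t} r *\<^sub>R norm (d r)))"
      using dn unfolding set_integrable_def by (rule integrable_mult_right)
    show "AE r in lborel. norm (indicator {s..t} r *\<^sub>R (?g n r \<bullet> d r)) \<le> K * (indicator {s..t} r *\<^sub>R norm (d r))" for n
      using simple_integrand_bound[OF R K \<xi>] by (intro AE_I2) (auto simp: indicator_def)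
    \<comment> \<open>The left end \<open>s\<close> lies in no half-open cell, but it is a single point.\<close>
    show "AE r in lborel. (\<lambda>n. indicator {s..t} r *\<^sub>R (?g n r \<bullet> d r)) \<longlonglongrightarrow> indicator {s..t} r *\<^sub>R (gF (v r + w r) \<bullet> d r)"
      using AE_lborel_singleton[of s]
    proof eventually_elim
      fix r assume "r \<noteq> s"
      show "(\<lambda>n. indicator {s..t} r *\<^sub>R (?g n r \<bullet> d r)) \<longlonglongrightarrow> indicator {s..t} r *\<^sub>R (gF (v r + w r) \<bullet> d r)"
      proof (cases "r \<in> {s..t}")
        case True
        with \<open>r \<noteq> s\<close> have r: "s < r" "r \<le> t" by auto
        have "\<exists>j. j \<le> n \<and> r \<in> {mesh s t n j <.. mesh s t n (Suc j)}" for n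
          by (rule mesh_cell[OF r, of n]) blast
        then obtain j where j: "\<And>n. j n \<le> n" "\<And>n. r \<in> {mesh s t n (j n) <.. mesh s t n (Suc (j n))}"
          by metis
        have g: "?g n r = gF (\<xi> n (j n))" for n
          unfolding cell_gradient_def by (rule sum_mesh_indicator[OF st j])
        have "(\<lambda>n. \<xi> n (j n)) \<longlonglongrightarrow> v r + w r"
          by (rule segment_point_converges[OF r j \<xi>])
        then have "(\<lambda>n. gF (\<xi> n (j n))) \<longlonglongrightarrow> gF (v r + w r)"
          by (rule continuous_on_tendsto_compose[OF cont_gF]) auto
        then show ?thesis unfolding g by (intro tendsto_intros)
      qed simp
    qed
  qed
qed

end


section \<open>A priori bounds for the singular equation\<close>

text \<open>
  Without a rough part the sums telescope, and the chain rule becomes the fundamental theorem of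
  calculus for a \<open>C\<^sup>1\<close> function of an absolutely continuous path.
\<close>

lemma (in finite_variation_path) fundamental_theorem:
  assumes "w = (\<lambda>_. 0)"
  shows "F (v t) - F (v s) = (LBINT r:{s..t}. gF (v r) \<bullet> d r)"
proof -
  have "riemann_sum n = (\<Sum>j\<le>n. F (v (mesh s t n (Suc j))) - F (v (mesh s t n j)))" for n
    unfolding riemann_sum_def by (simp add: assms)
  then have "riemann_sum n = F (v t) - F (v s)" for n
    using sum_telescope[of "\<lambda>j. - F (v (mesh s t n j))" n] by simp
  then have "riemann_sum = (\<lambda>_. F (v t) - F (v s))" by (intro ext)
  then have "(\<lambda>_::nat. F (v t) - F (v s)) \<longlonglongrightarrow> (LBINT r:{s..t}. gF (v r) \<bullet> d r)"
    using riemann_sum_tendsto assms by simp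
  then show ?thesis by (simp add: LIMSEQ_const_iff)
qed

text \<open>
  Think of \<open>x - c\<close> as the position relative to a configuration \<open>c\<close> whose gaps are at least \<open>1\<close>.
  After symmetrization the pair \<open>i, j\<close> contributes
  \<open>1 - (c\<^sub>i - c\<^sub>j) / (x\<^sub>i - x\<^sub>j) \<le> 1 - 1 / \<bar>x\<^sub>i - x\<^sub>j\<bar>\<close>: the repulsion bounds the energy from above,
  and the part not used for this still controls the size of the drift itself.
\<close>

lemma drift_energy_le:
  fixes x c :: "real ^ 'n::{finite,linorder}"
  assumes x: "x \<in> chamber_A" and dist: "\<And>i j. i \<noteq> j \<Longrightarrow> x $ i \<noteq> x $ j"
    and c: "\<And>i j. i < j \<Longrightarrow> c $ i - c $ j \<ge> 1"
  shows "2 * (\<Sum>i\<in>UNIV. (x $ i - c $ i) * drift_A i x) + (\<Sum>i\<in>UNIV. \<bar>drift_A i x\<bar>) \<le> real CARD('n) ^ 2"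
proof -
  have quotient: "(d - e) / d + \<bar>1 / d\<bar> \<le> 1" if "d > 0 \<and> e \<ge> 1 \<or> d < 0 \<and> e \<le> -1" for d e :: real
  proof -
    have "\<bar>1 / d\<bar> \<le> e / d"
      using that divide_right_mono[of 1 e d] divide_right_mono[of 1 "- e" "- d"] by auto
    then show ?thesis using that by (auto simp: diff_divide_distrib)
  qed
  have pair: "((x $ i - c $ i) - (x $ j - c $ j)) / (x $ i - x $ j) + \<bar>1 / (x $ i - x $ j)\<bar> \<le> 1"
    if "j \<noteq> i" for i j
  proof (cases "i < j")
    case True
    then have "x $ i > x $ j" using x dist[of i j] by (fastforce simp: chamber_A_def less_le)
    then show ?thesis using c[OF True] quotient[of "x $ i - x $ j" "c $ i - c $ j"] by (simp add: algebra_simps)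
  next
    case False
    with that have ji: "j < i" by auto
    then have "x $ j > x $ i" using x dist[of i j] by (fastforce simp: chamber_A_def less_le)
    then show ?thesis using c[OF ji] quotient[of "x $ i - x $ j" "c $ i - c $ j"] by (simp add: algebra_simps)
  qed
  have "2 * (\<Sum>i\<in>UNIV. (x $ i - c $ i) * drift_A i x) + (\<Sum>i\<in>UNIV. \<bar>drift_A i x\<bar>)
     \<le> (\<Sum>i\<in>UNIV. \<Sum>j\<in>UNIV - {i}. ((x $ i - c $ i) - (x $ j - c $ j)) / (x $ i - x $ j))
      + (\<Sum>i\<in>UNIV. \<Sum>j\<in>UNIV - {i}. \<bar>1 / (x $ i - x $ j)\<bar>)"
    unfolding sum_drift_A_symmetrize[of "\<lambda>i. x $ i - c $ i"]
    by (intro add_mono sum_mono) (auto simp: drift_A_def intro!: sum_abs simp del: abs_divide)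
  also have "\<dots> = (\<Sum>i\<in>UNIV. \<Sum>j\<in>UNIV - {i}. ((x $ i - c $ i) - (x $ j - c $ j)) / (x $ i - x $ j) + \<bar>1 / (x $ i - x $ j)\<bar>)"
    by (simp add: sum.distrib)
  also have "\<dots> \<le> (\<Sum>i\<in>(UNIV::'n set). \<Sum>j\<in>UNIV - {i}. 1)"
    by (intro sum_mono pair) auto
  also have "\<dots> \<le> (\<Sum>i\<in>(UNIV::'n set). \<Sum>j\<in>(UNIV::'n set). 1)"
    by (intro sum_mono sum_mono2) auto
  also have "\<dots> = real CARD('n) ^ 2" by (simp add: power2_eq_square)
  finally show ?thesis .
qed

definition drift_vec :: "real ^ 'n::finite \<Rightarrow> real ^ 'n" where
  "drift_vec x = (\<chi> i. drift_A i x)"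

lemma set_integrable_vec:
  fixes f :: "'n::finite \<Rightarrow> 'b \<Rightarrow> real"
  assumes "\<And>i. set_integrable M A (f i)"
  shows "set_integrable M A (\<lambda>r. (\<chi> i. f i r) :: real ^ 'n)"
    and "(LINT r:A|M. (\<chi> i. f i r) :: real ^ 'n) $ j = (LINT r:A|M. f j r)"
proof -
  have eq: "(\<chi> i. f i r) = (\<Sum>i\<in>UNIV. f i r *\<^sub>R (axis i 1 :: real ^ 'n))" for r
    by (simp add: vec_eq_iff axis_def sum.delta if_distrib cong: if_cong)
  have "integrable M (\<lambda>r. \<Sum>i\<in>UNIV. (indicator A r *\<^sub>R f i r) *\<^sub>R (axis i 1 :: real ^ 'n))"
    using assms unfolding set_integrable_def
    by (intro Bochner_Integration.integrable_sum integrable_scaleR_left) auto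
  then show int: "set_integrable M A (\<lambda>r. (\<chi> i. f i r) :: real ^ 'n)"
    unfolding set_integrable_def eq by (simp add: scaleR_sum_right)
  show "(LINT r:A|M. (\<chi> i. f i r) :: real ^ 'n) $ j = (LINT r:A|M. f j r)"
    using integral_bounded_linear[OF bounded_linear_vec_nth[of j] int[unfolded set_integrable_def]]
    by (simp add: set_lebesgue_integral_def)
qed

text \<open>
  A single trajectory of the equation: \<open>w\<close> is a fixed continuous function, and no probability enters.
\<close>

locale drift_path =
  fixes x w :: "real \<Rightarrow> real ^ 'n::{finite,linorder}" and x\<^sub>0 :: "real ^ 'n::{finite,linorder}" and T :: real
  assumes T: "0 \<le> T"
    and cont_w: "continuous_on {0..T} w" and cont_x: "continuous_on {0..T} x"
    and chamber: "u \<in> {0..T} \<Longrightarrow> x u \<in> chamber_A"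
    and distinct: "AE u in lborel. u \<in> {0..T} \<longrightarrow> (\<forall>i j. i \<noteq> j \<longrightarrow> x u $ i \<noteq> x u $ j)"
    and drift_int: "set_integrable lborel {0..T} (\<lambda>u. drift_A i (x u))"
    and path_eq: "u \<in> {0..T} \<Longrightarrow> x u $ i = x\<^sub>0 $ i + w u $ i + (LBINT r:{0..u}. drift_A i (x r))"
begin

text \<open>
  The part of finite variation.
\<close>

definition y :: "real \<Rightarrow> real ^ 'n::{finite,linorder}" where "y u = x u - w u"

lemma drift_vec_int: "set_integrable lborel {0..T} (\<lambda>u. drift_vec (x u))"
  unfolding drift_vec_def by (rule set_integrable_vec) (rule drift_int)

lemma y_eq:
  assumes "u \<in> {0..T}" shows "y u = x\<^sub>0 + (LBINT r:{0..u}. drift_vec (x r))"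
proof -
  have "set_integrable lborel {0..u} (\<lambda>u. drift_A i (x u))" for i
    by (rule set_integrable_subset[OF drift_int]) (use assms in auto)
  from set_integrable_vec(2)[of lborel "{0..u}" "\<lambda>i u. drift_A i (x u)", OF this] show ?thesis
    by (simp add: vec_eq_iff y_def path_eq[OF assms] drift_vec_def)
qed

lemma y_0: "y 0 = x\<^sub>0"
proof -
  have "(LBINT r:{0..0}. drift_vec (x r)) = 0"
    unfolding set_lebesgue_integral_def
  proof (rule integral_eq_zero_AE)
    show "AE r in lborel. indicator {0..0} r *\<^sub>R drift_vec (x r) = 0"
      using AE_lborel_singleton[of "0 :: real"] by eventually_elim simp
  qed
  then show ?thesis using y_eq[of 0] T by simp
qed

lemma y_diff:
  assumes "0 \<le> a" "a \<le> b" "b \<le> T"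
  shows "y b - y a = (LBINT r:{a<..b}. drift_vec (x r))"
proof -
  have "{0..b} = {0..a} \<union> {a<..b}" "{0..a} \<inter> {a<..b} = {}" using assms by auto
  then have "(LBINT r:{0..b}. drift_vec (x r)) = (LBINT r:{0..a}. drift_vec (x r)) + (LBINT r:{a<..b}. drift_vec (x r))"
    by (simp only:) (intro set_integral_Un set_integrable_subset[OF drift_vec_int], use assms in auto)
  then show ?thesis using y_eq[of a] y_eq[of b] assms by simp
qed

lemma cont_y: "continuous_on {0..T} y"
  unfolding y_def by (intro continuous_intros cont_x cont_w)

text \<open>
  Differentiating \<open>\<bar>y - a\<bar>\<^sup>2\<close> along the path: \<open>y - a = x - (w + a)\<close>, and \<open>w + a\<close> serves as the reference
  configuration with gaps at least \<open>1\<close>.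
\<close>

lemma energy_estimate:
  assumes a: "\<And>u i j. u \<in> {0..T} \<Longrightarrow> i < j \<Longrightarrow> (w u + a) $ i - (w u + a) $ j \<ge> 1"
    and u: "u \<in> {0..T}"
  shows "(norm (y u - a))\<^sup>2 + (LBINT r:{0..u}. (\<Sum>i\<in>UNIV. \<bar>drift_A i (x r)\<bar>))
      \<le> (norm (x\<^sub>0 - a))\<^sup>2 + (real CARD('n))\<^sup>2 * u"
proof -
  have sub: "{0..u} \<subseteq> {0..T}" using u by auto
  interpret fv: finite_variation_path "\<lambda>z. (z - a) \<bullet> (z - a)" "\<lambda>z. 2 *\<^sub>R (z - a)"
      y "\<lambda>_. 0" "\<lambda>u. drift_vec (x u)" 0 u
  proof
    show "((\<lambda>z. (z - a) \<bullet> (z - a)) has_derivative (\<lambda>h. 2 *\<^sub>R (z - a) \<bullet> h)) (at z)" for z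
      by (auto intro!: derivative_eq_intros simp: inner_commute)
    show "set_integrable lborel {0..u} (\<lambda>u. drift_vec (x u))"
      by (rule set_integrable_subset[OF drift_vec_int]) (use sub in auto)
    show "continuous_on {0..u} y" using cont_y sub by (rule continuous_on_subset)
  qed (use u y_diff in \<open>auto intro!: continuous_intros\<close>)
  let ?D = "\<lambda>r. \<Sum>i\<in>UNIV. \<bar>drift_A i (x r)\<bar>"
  have intD: "set_integrable lborel {0..u} ?D"
    unfolding set_integrable_def scaleR_sum_right
    by (intro Bochner_Integration.integrable_sum
        set_integrable_abs[OF set_integrable_subset[OF drift_int], unfolded set_integrable_def])
      (use sub in auto)
  have intE: "set_integrable lborel {0..u} (\<lambda>r. 2 *\<^sub>R (y r - a) \<bullet> drift_vec (x r))"
    using fv.integrable_gradient by simp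
  have intN: "set_integrable lborel {0..u} (\<lambda>_. (real CARD('n))\<^sup>2)"
    by (rule borel_integrable_atLeastAtMost') auto
  have "(norm (y u - a))\<^sup>2 - (norm (x\<^sub>0 - a))\<^sup>2 = (LBINT r:{0..u}. 2 *\<^sub>R (y r - a) \<bullet> drift_vec (x r))"
    using fv.fundamental_theorem by (simp add: y_0 power2_norm_eq_inner)
  also have "\<dots> + (LBINT r:{0..u}. ?D r) = (LBINT r:{0..u}. 2 *\<^sub>R (y r - a) \<bullet> drift_vec (x r) + ?D r)"
    by (rule set_integral_add(2)[symmetric, OF intE intD])
  also have "\<dots> \<le> (LBINT r:{0..u}. (real CARD('n))\<^sup>2)"
  proof (rule set_integral_mono_AE[OF set_integral_add(1)[OF intE intD] intN])
    show "AE r\<in>{0..u} in lborel. 2 *\<^sub>R (y r - a) \<bullet> drift_vec (x r) + ?D r \<le> (real CARD('n))\<^sup>2"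
      using distinct
    proof eventually_elim
      fix r assume d: "r \<in> {0..T} \<longrightarrow> (\<forall>i j. i \<noteq> j \<longrightarrow> x r $ i \<noteq> x r $ j)"
      show "r \<in> {0..u} \<longrightarrow> 2 *\<^sub>R (y r - a) \<bullet> drift_vec (x r) + ?D r \<le> (real CARD('n))\<^sup>2"
      proof
        assume "r \<in> {0..u}"
        then have r: "r \<in> {0..T}" using sub by auto
        have "2 *\<^sub>R (y r - a) \<bullet> drift_vec (x r) = 2 * (\<Sum>i\<in>UNIV. (x r $ i - (w r + a) $ i) * drift_A i (x r))"
          by (simp add: inner_vec_def drift_vec_def y_def sum_distrib_left algebra_simps)
        then show "2 *\<^sub>R (y r - a) \<bullet> drift_vec (x r) + ?D r \<le> (real CARD('n))\<^sup>2"
          using drift_energy_le[OF chamber[OF r], of "w r + a"] d r a[OF r] by simp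
      qed
    qed
  qed
  also have "\<dots> = (real CARD('n))\<^sup>2 * u"
    using u by (simp add: set_lebesgue_integral_def)
  finally show ?thesis by simp
qed

definition bound_const :: real where
  "bound_const = 4 * (real CARD('n))\<^sup>2 + norm x\<^sub>0 + real CARD('n) * (1 + T) + 1"

text \<open>
  Both the path and the total variation of its drift are controlled by the supremum of the
  driving function. This replaces every stochastic estimate on the singular drift.
\<close>

lemma a_priori_bounds:
  assumes b: "\<And>u. u \<in> {0..T} \<Longrightarrow> norm (w u) \<le> b"
  shows "u \<in> {0..T} \<Longrightarrow> norm (y u) + norm (w u) \<le> bound_const * (1 + b)"
    and "(LBINT r:{0..T}. norm (drift_vec (x r))) \<le> (bound_const * (1 + b))\<^sup>2"
proof -
  let ?N = "real CARD('n)"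
  have b0: "0 \<le> b" using order.trans[OF norm_ge_zero b[of 0]] T by simp
  \<comment> \<open>Gaps \<open>2 * b + 1\<close> survive as gaps of at least \<open>1\<close> when both coordinates move by at most \<open>b\<close>.\<close>
  define a :: "real ^ 'n::{finite,linorder}" where "a = (\<chi> i. - (2 * b + 1) * real (card {j. j < i}))"
  have gap: "(w u + a) $ i - (w u + a) $ j \<ge> 1" if u: "u \<in> {0..T}" and ij: "i < j" for u i j
  proof -
    have "card {k. k < i} < card {k. k < j}"
      using ij by (intro psubset_card_mono) auto
    then have "real (card {k. k < i}) + 1 \<le> real (card {k. k < j})" by linarith
    then have "(2 * b + 1) * (real (card {k. k < i}) + 1) \<le> (2 * b + 1) * real (card {k. k < j})"
      using b0 by (intro mult_left_mono) auto
    moreover have "\<bar>w u $ i\<bar> \<le> b" "\<bar>w u $ j\<bar> \<le> b"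
      using b[OF u] component_le_norm_cart[of "w u"] order.trans by blast+
    ultimately show ?thesis by (simp add: a_def algebra_simps abs_le_iff)
  qed
  have "norm a \<le> (\<Sum>i\<in>UNIV. \<bar>a $ i\<bar>)" by (rule norm_le_l1_cart)
  also have "\<dots> \<le> (\<Sum>i\<in>(UNIV :: 'n set). (2 * b + 1) * ?N)"
  proof (rule sum_mono)
    fix i :: 'n
    have "real (card {j. j < i}) \<le> ?N" by (simp add: card_mono)
    then have "(2 * b + 1) * real (card {j. j < i}) \<le> (2 * b + 1) * ?N" using b0 by (intro mult_left_mono) auto
    moreover have "\<bar>a $ i\<bar> = (2 * b + 1) * real (card {j. j < i})" using b0 by (simp add: a_def abs_mult)
    ultimately show "\<bar>a $ i\<bar> \<le> (2 * b + 1) * ?N" by simp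
  qed
  finally have norm_a: "norm a \<le> (2 * b + 1) * ?N\<^sup>2" by (simp add: power2_eq_square mult_ac)
  have N: "?N \<ge> 1" by (simp add: Suc_le_eq)
  \<comment> \<open>\<open>L\<^sup>2\<close> dominates the right-hand side of the energy estimate; \<open>1 + T\<close> avoids a square root of \<open>T\<close>.\<close>
  define L where "L = norm (x\<^sub>0 - a) + ?N * (1 + T)"
  have L0: "L \<ge> 0" using T by (simp add: L_def)
  have sq: "(norm (x\<^sub>0 - a))\<^sup>2 + ?N\<^sup>2 * u \<le> L\<^sup>2" if "u \<in> {0..T}" for u
  proof -
    have "u \<le> T" using that by simp
    moreover have "(1 + T)\<^sup>2 = 1 + T + T + T * T" by (simp add: power2_eq_square algebra_simps)
    ultimately have "u \<le> (1 + T)\<^sup>2" using T mult_nonneg_nonneg[OF T T] by linarith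
    then have "?N\<^sup>2 * u \<le> (?N * (1 + T))\<^sup>2" by (simp add: power_mult_distrib mult_left_mono)
    moreover have "0 \<le> 2 * norm (x\<^sub>0 - a) * (?N * (1 + T))" using T by simp
    ultimately show ?thesis unfolding L_def power2_sum by linarith
  qed
  have L_le: "norm a + L + b \<le> bound_const * (1 + b)"
  proof -
    have "norm a + L + b \<le> 2 * ((2 * b + 1) * ?N\<^sup>2) + norm x\<^sub>0 + ?N * (1 + T) + b"
      using norm_a norm_triangle_ineq4[of x\<^sub>0 a] unfolding L_def by linarith
    also have "\<dots> \<le> bound_const * (1 + b)"
      using b0 T by (simp add: bound_const_def algebra_simps)
    finally show ?thesis .
  qed
  have Dnn: "0 \<le> (LBINT r:{0..u}. (\<Sum>i\<in>UNIV. \<bar>drift_A i (x r)\<bar>))" for u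
    unfolding set_lebesgue_integral_def by (intro integral_nonneg_AE AE_I2) (simp add: sum_nonneg)
  show "norm (y u) + norm (w u) \<le> bound_const * (1 + b)" if u: "u \<in> {0..T}"
  proof -
    have "(norm (y u - a))\<^sup>2 \<le> L\<^sup>2" using energy_estimate[OF gap u] sq[OF u] Dnn[of u] by linarith
    then have "norm (y u - a) \<le> L" using L0 by (rule power2_le_imp_le)
    moreover have "norm (y u) \<le> norm (y u - a) + norm a" using norm_triangle_ineq[of "y u - a" a] by simp
    ultimately show ?thesis using b[OF u] L_le by linarith
  qed
  have TT: "T \<in> {0..T}" using T by simp
  have intD: "set_integrable lborel {0..T} (\<lambda>r. \<Sum>i\<in>UNIV. \<bar>drift_A i (x r)\<bar>)"
    unfolding set_integrable_def scaleR_sum_right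
    by (intro Bochner_Integration.integrable_sum
        set_integrable_abs[OF drift_int, unfolded set_integrable_def])
  have "(LBINT r:{0..T}. norm (drift_vec (x r))) \<le> (LBINT r:{0..T}. (\<Sum>i\<in>UNIV. \<bar>drift_A i (x r)\<bar>))"
    by (intro set_integral_mono set_integrable_norm drift_vec_int intD)
       (use norm_le_l1_cart[of "drift_vec (x _)"] in \<open>simp add: drift_vec_def\<close>)
  also have "\<dots> \<le> L\<^sup>2" using energy_estimate[OF gap TT] sq[OF TT] zero_le_power2[of "norm (y T - a)"] by linarith
  also have "\<dots> \<le> (bound_const * (1 + b))\<^sup>2"
    using L_le L0 b0 norm_ge_zero[of a] by (intro power_mono) linarith+
  finally show "(LBINT r:{0..T}. norm (drift_vec (x r))) \<le> (bound_const * (1 + b))\<^sup>2" .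
qed

end


section \<open>The space-time polynomial\<close>

definition heat_coeff :: "nat \<Rightarrow> nat \<Rightarrow> nat \<Rightarrow> real" where
  "heat_coeff N k l = fact (N - k + 2 * l) / (2 ^ l * fact l * fact (N - k))"

text \<open>
  The recursion that makes consecutive terms cancel: the factor on the right is the one
  produced by the drift acting on \<open>e\<^sub>k\<^sub>-\<^sub>2\<^sub>l\<close>.
\<close>

lemma heat_coeff_Suc:
  "heat_coeff N k (Suc l) * real (Suc l)
   = heat_coeff N k l * (real (N - k + 2 * l + 2) * real (N - k + 2 * l + 1) / 2)"
proof -
  have "fact (N - k + 2 * Suc l) = real (N - k + 2 * l + 2) * real (N - k + 2 * l + 1) * fact (N - k + 2 * l)"
    by (simp add: algebra_simps)
  then show ?thesis
    unfolding heat_coeff_def by (simp add: divide_simps del: of_nat_Suc of_nat_add)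
qed

text \<open>
  A space-time harmonic polynomial for the generator: its time derivative compensates the drift.
\<close>

definition heat_poly :: "nat \<Rightarrow> real \<times> (real ^ 'n::finite) \<Rightarrow> real" where
  "heat_poly k z = (\<Sum>l\<le>k div 2. heat_coeff CARD('n) k l * fst z ^ l * esym (k - 2 * l) (snd z))"

definition heat_gradient :: "nat \<Rightarrow> real \<times> (real ^ 'n::finite) \<Rightarrow> real \<times> (real ^ 'n)" where
  "heat_gradient k z =
    (\<Sum>l\<le>k div 2. heat_coeff CARD('n) k l * (real l * fst z ^ (l - 1)) * esym (k - 2 * l) (snd z),
     \<chi> i. \<Sum>l\<le>k div 2. heat_coeff CARD('n) k l * fst z ^ l * esym_partial (k - 2 * l) i (snd z))"

lemma heat_poly_has_derivative:
  "(heat_poly k has_derivative (\<lambda>h. heat_gradient k z \<bullet> h)) (at z)"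
proof -
  let ?c = "heat_coeff CARD('a) k"
  have "((\<lambda>z. ?c l * fst z ^ l * esym (k - 2 * l) (snd z)) has_derivative
     (\<lambda>h. ?c l * (real l * fst z ^ (l - 1)) * esym (k - 2 * l) (snd z) * fst h
        + (\<Sum>i\<in>UNIV. ?c l * fst z ^ l * esym_partial (k - 2 * l) i (snd z) * snd h $ i))) (at z)" for l
  proof -
    have e: "((\<lambda>z. esym (k - 2 * l) (snd z)) has_derivative
       (\<lambda>h. \<Sum>i\<in>UNIV. esym_partial (k - 2 * l) i (snd z) * snd h $ i)) (at z)"
      by (rule has_derivative_compose[OF has_derivative_snd[OF has_derivative_ident] esym_has_derivative])
    have f: "((\<lambda>z. ?c l * fst z ^ l) has_derivative (\<lambda>h. ?c l * (real l * fst z ^ (l - 1)) * fst h)) (at z)"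
      by (auto intro!: derivative_eq_intros simp: mult_ac)
    show ?thesis
      using has_derivative_mult[OF f e]
      by (rule has_derivative_eq_rhs) (auto simp: sum_distrib_left mult_ac)
  qed
  then have "(heat_poly k has_derivative (\<lambda>h. \<Sum>l\<le>k div 2.
       ?c l * (real l * fst z ^ (l - 1)) * esym (k - 2 * l) (snd z) * fst h
        + (\<Sum>i\<in>UNIV. ?c l * fst z ^ l * esym_partial (k - 2 * l) i (snd z) * snd h $ i))) (at z)"
    unfolding heat_poly_def[abs_def] by (intro has_derivative_sum)
  moreover have "(\<Sum>l\<le>k div 2.
       ?c l * (real l * fst z ^ (l - 1)) * esym (k - 2 * l) (snd z) * fst h
        + (\<Sum>i\<in>UNIV. ?c l * fst z ^ l * esym_partial (k - 2 * l) i (snd z) * snd h $ i))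
     = heat_gradient k z \<bullet> h" for h
    unfolding sum.distrib sum.swap[of _ UNIV] heat_gradient_def inner_prod_def inner_vec_def
    by (simp add: sum_distrib_right)
  ultimately show ?thesis by simp
qed

lemma continuous_on_esym: "continuous_on A (esym k)"
  unfolding esym_def by (intro continuous_intros)

lemma continuous_on_esym_partial: "continuous_on A (esym_partial k i)"
  unfolding esym_partial_eq by (intro continuous_intros)

lemma continuous_on_heat_gradient: "continuous_on A (heat_gradient k)"
  unfolding heat_gradient_def
  by (intro continuous_intros continuous_on_vec_lambda
      continuous_on_compose2[OF continuous_on_esym[of UNIV]]
      continuous_on_compose2[OF continuous_on_esym_partial[of UNIV]]) auto

interpretation heat: smooth_function "heat_poly k" "heat_gradient k" for k
  by standard (rule heat_poly_has_derivative continuous_on_heat_gradient)+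

text \<open>
  The time derivative of the term \<open>l + 1\<close> cancels the drift derivative of the term \<open>l\<close>; the time
  derivative vanishes for \<open>l = 0\<close>, and the drift annihilates the last term, of degree at most one.
\<close>

lemma heat_gradient_drift:
  fixes x :: "real ^ 'n::finite"
  assumes dist: "\<And>i j. i \<noteq> j \<Longrightarrow> x $ i \<noteq> x $ j" and k: "k \<le> CARD('n)"
  shows "heat_gradient k (u, x) \<bullet> (1, \<chi> i. drift_A i x) = 0"
proof -
  let ?N = "CARD('n)" and ?K = "k div 2"
  define q where "q l = heat_coeff ?N k l * (real l * u ^ (l - 1)) * esym (k - 2 * l) x" for l
  have space: "heat_coeff ?N k l * u ^ l * (\<Sum>i\<in>UNIV. esym_partial (k - 2 * l) i x * drift_A i x)
      = (if l < ?K then - q (Suc l) else 0)" if "l \<le> ?K" for l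
  proof (cases "l < ?K")
    case True
    then have ge: "\<not> k - 2 * l < 2" by linarith
    have idx: "?N - (k - 2 * l) = ?N - k + 2 * l" "k - 2 * l - 2 = k - 2 * Suc l" using True k by auto
    have "heat_coeff ?N k l * u ^ l * (\<Sum>i\<in>UNIV. esym_partial (k - 2 * l) i x * drift_A i x)
      = - (heat_coeff ?N k l * (real (?N - k + 2 * l + 2) * real (?N - k + 2 * l + 1) / 2)) * u ^ l * esym (k - 2 * Suc l) x"
      using drift_esym[OF dist, of "k - 2 * l"] k ge unfolding idx by simp
    also have "\<dots> = - q (Suc l)"
      unfolding heat_coeff_Suc[symmetric] q_def by simp
    finally show ?thesis using True by simp
  next
    case False
    then have "k - 2 * l < 2" using that by linarith
    then show ?thesis using drift_esym[OF dist, of "k - 2 * l"] k False by simp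
  qed
  have "heat_gradient k (u, x) \<bullet> (1, \<chi> i. drift_A i x)
     = (\<Sum>l\<le>?K. q l) + (\<Sum>l\<le>?K. heat_coeff ?N k l * u ^ l * (\<Sum>i\<in>UNIV. esym_partial (k - 2 * l) i x * drift_A i x))"
    unfolding heat_gradient_def q_def inner_prod_def inner_vec_def
    by (simp add: sum_distrib_right sum_distrib_left sum.swap[of _ UNIV] mult.assoc)
  also have "(\<Sum>l\<le>?K. heat_coeff ?N k l * u ^ l * (\<Sum>i\<in>UNIV. esym_partial (k - 2 * l) i x * drift_A i x))
     = (\<Sum>l\<le>?K. if l < ?K then - q (Suc l) else 0)"
    using space by (intro sum.cong) auto
  also have "\<dots> = - (\<Sum>l<?K. q (Suc l))"
    by (simp add: lessThan_Suc_atMost[symmetric] sum_negf)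
  also have "(\<Sum>l\<le>?K. q l) = q 0 + (\<Sum>l<?K. q (Suc l))"
    by (rule sum.atMost_shift)
  finally show ?thesis by (simp add: q_def)
qed

text \<open>
  Polynomial growth keeps the gradient integrable along a path whose supremum has all moments.
\<close>

definition poly_growth :: "('v::real_normed_vector \<Rightarrow> 'w::real_normed_vector) \<Rightarrow> bool" where
  "poly_growth f \<longleftrightarrow> (\<exists>C q. \<forall>z. norm (f z) \<le> C * (1 + norm z) ^ q)"

lemma poly_growthE:
  assumes "poly_growth f"
  obtains C q where "C \<ge> 0" "\<And>z. norm (f z) \<le> C * (1 + norm z) ^ q"
proof -
  obtain C q where C: "\<And>z. norm (f z) \<le> C * (1 + norm z) ^ q" using assms by (auto simp: poly_growth_def)
  have "0 \<le> C" using order.trans[OF norm_ge_zero C[of 0]] by simp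
  with C that show thesis by blast
qed

lemma poly_growth_dominated:
  assumes "poly_growth g" "\<And>z. norm (f z) \<le> norm (g z)"
  shows "poly_growth f"
  using assms unfolding poly_growth_def by (meson order.trans)

lemma poly_growth_const: "poly_growth (\<lambda>_. c)"
  unfolding poly_growth_def by (intro exI[of _ "norm c"] exI[of _ 0]) simp

lemma poly_growth_ident: "poly_growth (\<lambda>z. z)"
  unfolding poly_growth_def by (intro exI[of _ 1]) (simp add: add.commute)

lemma poly_growth_add:
  assumes "poly_growth f" "poly_growth g" shows "poly_growth (\<lambda>z. f z + g z)"
proof -
  obtain C q where C: "C \<ge> 0" "\<And>z. norm (f z) \<le> C * (1 + norm z) ^ q" using poly_growthE[OF assms(1)] by blast
  obtain D r where D: "D \<ge> 0" "\<And>z. norm (g z) \<le> D * (1 + norm z) ^ r" using poly_growthE[OF assms(2)] by blast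
  have "norm (f z + g z) \<le> (C + D) * (1 + norm z) ^ (q + r)" for z
  proof -
    have "(1 + norm z) ^ q \<le> (1 + norm z) ^ (q + r)" "(1 + norm z) ^ r \<le> (1 + norm z) ^ (q + r)"
      by (intro power_increasing; simp)+
    then have "C * (1 + norm z) ^ q \<le> C * (1 + norm z) ^ (q + r)" "D * (1 + norm z) ^ r \<le> D * (1 + norm z) ^ (q + r)"
      using C D by (auto intro: mult_left_mono)
    then show ?thesis using norm_triangle_ineq[of "f z" "g z"] C(2)[of z] D(2)[of z] unfolding distrib_right by linarith
  qed
  then show ?thesis unfolding poly_growth_def by blast
qed

lemma poly_growth_mult:
  fixes f g :: "'v::real_normed_vector \<Rightarrow> real"
  assumes "poly_growth f" "poly_growth g" shows "poly_growth (\<lambda>z. f z * g z)"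
proof -
  obtain C q where C: "C \<ge> 0" "\<And>z. norm (f z) \<le> C * (1 + norm z) ^ q" using poly_growthE[OF assms(1)] by blast
  obtain D r where D: "D \<ge> 0" "\<And>z. norm (g z) \<le> D * (1 + norm z) ^ r" using poly_growthE[OF assms(2)] by blast
  have "norm (f z * g z) \<le> (C * D) * (1 + norm z) ^ (q + r)" for z
  proof -
    have "norm (f z * g z) = norm (f z) * norm (g z)" by (rule norm_mult)
    also have "\<dots> \<le> (C * (1 + norm z) ^ q) * (D * (1 + norm z) ^ r)"
      using C D by (intro mult_mono) auto
    finally show ?thesis by (simp add: power_add mult_ac)
  qed
  then show ?thesis unfolding poly_growth_def by blast
qed

lemma poly_growth_sum:
  "(\<And>i. i \<in> I \<Longrightarrow> poly_growth (f i)) \<Longrightarrow> poly_growth (\<lambda>z. \<Sum>i\<in>I. f i z)"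
  by (induction I rule: infinite_finite_induct) (auto intro: poly_growth_const poly_growth_add)

lemma poly_growth_prod:
  fixes f :: "'i \<Rightarrow> 'v::real_normed_vector \<Rightarrow> real"
  shows "(\<And>i. i \<in> I \<Longrightarrow> poly_growth (f i)) \<Longrightarrow> poly_growth (\<lambda>z. \<Prod>i\<in>I. f i z)"
  by (induction I rule: infinite_finite_induct) (auto intro: poly_growth_const poly_growth_mult)

lemma poly_growth_power:
  fixes f :: "'v::real_normed_vector \<Rightarrow> real"
  shows "poly_growth f \<Longrightarrow> poly_growth (\<lambda>z. f z ^ m)"
  by (induction m) (auto intro: poly_growth_const poly_growth_mult)

lemma poly_growth_fst: "poly_growth (\<lambda>z. fst z)"
  by (rule poly_growth_dominated[OF poly_growth_ident]) (metis norm_fst_le prod.collapse)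

lemma poly_growth_snd_nth:
  "poly_growth (\<lambda>z :: 'v::real_normed_vector \<times> (real ^ 'n::finite). snd z $ i)"
proof (rule poly_growth_dominated[OF poly_growth_ident])
  fix z :: "'v \<times> (real ^ 'n)"
  have "\<bar>snd z $ i\<bar> \<le> norm (snd z)" by (rule component_le_norm_cart)
  also have "\<dots> \<le> norm z" using norm_snd_le[of "snd z" "fst z"] by simp
  finally show "norm (snd z $ i) \<le> norm z" by simp
qed

lemma poly_growth_norm: "poly_growth f \<Longrightarrow> poly_growth (\<lambda>z. norm (f z))"
  unfolding poly_growth_def by simp

lemma poly_growth_Pair:
  assumes "poly_growth f" "poly_growth g" shows "poly_growth (\<lambda>z. (f z, g z))"
  by (rule poly_growth_dominated[OF poly_growth_add[OF poly_growth_norm[OF assms(1)] poly_growth_norm[OF assms(2)]]])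
     (simp add: norm_Pair_le)

lemma poly_growth_vec:
  assumes "\<And>i. poly_growth (f i)" shows "poly_growth (\<lambda>z. (\<chi> i. f i z) :: real ^ 'n::finite)"
proof (rule poly_growth_dominated)
  show "poly_growth (\<lambda>z. \<Sum>i\<in>(UNIV :: 'n set). norm (f i z))"
    by (intro poly_growth_sum poly_growth_norm assms)
  show "norm ((\<chi> i. f i z) :: real ^ 'n) \<le> norm (\<Sum>i\<in>(UNIV :: 'n set). norm (f i z))" for z
    using norm_le_l1_cart[of "(\<chi> i. f i z) :: real ^ 'n"] by (simp add: sum_nonneg)
qed

lemma poly_growth_esym: "poly_growth (\<lambda>z. esym k (snd z))"
  unfolding esym_def by (intro poly_growth_sum poly_growth_prod poly_growth_snd_nth)

lemma poly_growth_esym_partial: "poly_growth (\<lambda>z. esym_partial k i (snd z))"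
  unfolding esym_partial_eq by (intro poly_growth_sum poly_growth_prod poly_growth_snd_nth)

lemma poly_growth_heat_gradient: "poly_growth (heat_gradient k)"
  unfolding heat_gradient_def[abs_def]
  by (intro poly_growth_Pair poly_growth_vec poly_growth_sum poly_growth_mult poly_growth_const
      poly_growth_power poly_growth_fst poly_growth_esym poly_growth_esym_partial)


section \<open>Increments of Brownian motion against its past\<close>

lemma space_canonical_filtration [simp]: "space (canonical_filtration M B t) = space M"
  by (simp add: canonical_filtration_def space_measure_of_conv)

lemma raw_filtration_generators:
  "{B s -` A \<inter> space M | s A. 0 \<le> s \<and> s \<le> t \<and> A \<in> sets borel} \<subseteq> Pow (space M)"
  by auto

lemma sets_raw_filtration:
  "sets (raw_filtration M B t) = sigma_sets (space M) {B s -` A \<inter> space M | s A. 0 \<le> s \<and> s \<le> t \<and> A \<in> sets borel}"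
  unfolding raw_filtration_def by (rule sets_measure_of[OF raw_filtration_generators])

lemma space_raw_filtration [simp]: "space (raw_filtration M B t) = space M"
  by (simp add: raw_filtration_def space_measure_of_conv)

lemma canonical_filtration_generators:
  "sets (raw_filtration M B t) \<union> null_sets M \<subseteq> Pow (space M)"
  using sets.space_closed[of "raw_filtration M B t"] sets.space_closed[of M] by (auto simp: null_sets_def)

lemma sets_canonical_filtration:
  "sets (canonical_filtration M B t) = sigma_sets (space M) (sets (raw_filtration M B t) \<union> null_sets M)"
  unfolding canonical_filtration_def by (rule sets_measure_of[OF canonical_filtration_generators])

lemma abs_prod_vec_le:
  fixes v :: "real ^ 'm::finite"
  shows "\<bar>\<Prod>i\<in>S. v $ i\<bar> \<le> (1 + norm v) ^ CARD('m)"
proof -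
  have "\<bar>\<Prod>i\<in>S. v $ i\<bar> = (\<Prod>i\<in>S. \<bar>v $ i\<bar>)" by (rule abs_prod)
  also have "\<dots> \<le> (\<Prod>i\<in>S. 1 + norm v)"
  proof (rule prod_mono)
    fix i show "0 \<le> \<bar>v $ i\<bar> \<and> \<bar>v $ i\<bar> \<le> 1 + norm v"
      using component_le_norm_cart[of v i] by linarith
  qed
  also have "\<dots> = (1 + norm v) ^ card S" by simp
  also have "\<dots> \<le> (1 + norm v) ^ CARD('m)" by (intro power_increasing card_mono) auto
  finally show ?thesis .
qed

locale brownian = prob_space M for M :: "'a measure" +
  fixes B :: "real \<Rightarrow> 'a \<Rightarrow> real ^ 'n::finite"
  assumes bm: "brownian_motion M B"
begin

abbreviation "\<F> \<equiv> canonical_filtration M B"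

lemma measurable_B: "0 \<le> t \<Longrightarrow> B t \<in> borel_measurable M"
  using bm by (simp add: brownian_motion_def)

lemma raw_filtration_events: "sets (raw_filtration M B t) \<subseteq> events"
  unfolding sets_raw_filtration
  by (rule sets.sigma_sets_subset) (auto intro!: measurable_sets[OF measurable_B])

lemma raw_filtration_mono: "s \<le> t \<Longrightarrow> sets (raw_filtration M B s) \<subseteq> sets (raw_filtration M B t)"
  unfolding sets_raw_filtration by (rule sigma_sets_mono') force

lemma subalgebra_canonical: "subalgebra M (\<F> t)"
  unfolding subalgebra_def sets_canonical_filtration
  using raw_filtration_events[of t]
  by (intro conjI sets.sigma_sets_subset) (auto simp: null_sets_def)

lemma subalgebra_canonical_mono: "s \<le> t \<Longrightarrow> subalgebra (\<F> t) (\<F> s)"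
  unfolding subalgebra_def sets_canonical_filtration
  using raw_filtration_mono[of s t] by (intro conjI sigma_sets_mono') auto

lemma canonical_measurable: "f \<in> measurable (\<F> s) N \<Longrightarrow> f \<in> measurable M N"
  by (rule measurable_from_subalg[OF subalgebra_canonical])

text \<open>
  Null sets are independent of everything, so augmenting the filtration preserves the independence
  of increments: the union of the raw \<open>\<sigma>\<close>-algebra and the null sets is still stable under
  intersection.
\<close>

lemma indep_canonical_increment:
  assumes st: "0 \<le> s" "s < t"
    and f: "f \<in> borel_measurable (\<F> s)" and g: "g \<in> borel_measurable borel"
  shows "indep_var borel (f :: 'a \<Rightarrow> real) borel (\<lambda>\<omega>. g (B t \<omega> - B s \<omega>) :: real)"
proof -
  let ?R = "sets (raw_filtration M B s)"
  let ?I = "{(\<lambda>\<omega>. B t \<omega> - B s \<omega>) -` A \<inter> space M | A. A \<in> sets borel}"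
  have inc [measurable]: "(\<lambda>\<omega>. B t \<omega> - B s \<omega>) \<in> borel_measurable M"
    using measurable_B[of s] measurable_B[of t] st by simp
  have raw: "indep_set ?R ?I" using bm st by (simp add: brownian_motion_def)
  have "indep_set (?R \<union> null_sets M) ?I"
    unfolding indep_sets2_eq
  proof (intro conjI ballI)
    show "?R \<union> null_sets M \<subseteq> events" using raw_filtration_events[of s] by auto
    show I: "?I \<subseteq> events" using measurable_sets[OF inc] by auto
    fix a b assume a: "a \<in> ?R \<union> null_sets M" and b: "b \<in> ?I"
    show "prob (a \<inter> b) = prob a * prob b"
    proof (cases "a \<in> ?R")
      case True
      then show ?thesis using raw b unfolding indep_sets2_eq by blast
    next
      case False
      with a have a0: "a \<in> null_sets M" by auto
      have "b \<in> events" using I b by blast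
      with a0 have "a \<inter> b \<in> null_sets M" by (rule null_set_Int2)
      then show ?thesis using a0 by (simp add: measure_eq_emeasure_eq_ennreal null_setsD1)
    qed
  qed
  moreover have "Int_stable (?R \<union> null_sets M)"
  proof (rule Int_stableI)
    fix a b assume ab: "a \<in> ?R \<union> null_sets M" "b \<in> ?R \<union> null_sets M"
    then have ev: "a \<in> events" "b \<in> events" using raw_filtration_events[of s] by auto
    show "a \<inter> b \<in> ?R \<union> null_sets M"
      using ab null_set_Int1[of b M a] null_set_Int2[of a M b] ev by blast
  qed
  moreover have "Int_stable ?I"
  proof (rule Int_stableI)
    fix a b assume "a \<in> ?I" "b \<in> ?I"
    then obtain A A' where "a = (\<lambda>\<omega>. B t \<omega> - B s \<omega>) -` A \<inter> space M" "A \<in> sets borel"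
      "b = (\<lambda>\<omega>. B t \<omega> - B s \<omega>) -` A' \<inter> space M" "A' \<in> sets borel" by blast
    then show "a \<inter> b \<in> ?I" by (intro CollectI exI[of _ "A \<inter> A'"]) auto
  qed
  ultimately have "indep_set (sets (\<F> s)) (sigma_sets (space M) ?I)"
    unfolding sets_canonical_filtration by (rule indep_set_sigma_sets)
  then have ind: "sets (\<F> s) \<subseteq> events" "sigma_sets (space M) ?I \<subseteq> events"
    "\<And>a b. a \<in> sets (\<F> s) \<Longrightarrow> b \<in> sigma_sets (space M) ?I \<Longrightarrow> prob (a \<inter> b) = prob a * prob b"
    unfolding indep_sets2_eq by blast+
  have sub_f: "sigma_sets (space M) {f -` A \<inter> space M | A. A \<in> sets borel} \<subseteq> sets (\<F> s)"
    using sets.sigma_sets_subset[of "{f -` A \<inter> space M | A. A \<in> sets borel}" "\<F> s"] measurable_sets[OF f]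
    by auto
  have sub_g: "sigma_sets (space M) {(\<lambda>\<omega>. g (B t \<omega> - B s \<omega>)) -` A \<inter> space M | A. A \<in> sets borel}
      \<subseteq> sigma_sets (space M) ?I"
  proof (rule sigma_sets_mono', clarify)
    fix A :: "real set" assume "A \<in> sets borel"
    then have "g -` A \<in> sets borel" using measurable_sets[OF g] by simp
    then show "\<exists>A'. (\<lambda>\<omega>. g (B t \<omega> - B s \<omega>)) -` A \<inter> space M = (\<lambda>\<omega>. B t \<omega> - B s \<omega>) -` A' \<inter> space M \<and> A' \<in> sets borel"
      by (intro exI[of _ "g -` A"]) auto
  qed
  have "(\<lambda>\<omega>. g (B t \<omega> - B s \<omega>)) \<in> borel_measurable M" using measurable_compose[OF inc g] .
  then show ?thesis
    unfolding indep_var_eq indep_sets2_eq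
    using ind sub_f sub_g canonical_measurable[OF f] by blast
qed

lemma expectation_times_increment_prod:
  assumes st: "0 \<le> s" "s < t"
    and f: "f \<in> borel_measurable (\<F> s)" "integrable M f" and T: "T \<noteq> {}"
  shows "integrable M (\<lambda>\<omega>. f \<omega> * (\<Prod>i\<in>T. (B t \<omega> - B s \<omega>) $ i))"
    and "expectation (\<lambda>\<omega>. f \<omega> * (\<Prod>i\<in>T. (B t \<omega> - B s \<omega>) $ i)) = 0"
proof -
  have "(\<lambda>v :: real ^ 'n. \<Prod>i\<in>T. v $ i) \<in> borel_measurable borel" by measurable
  from indep_canonical_increment[OF st f(1) this]
  have ind: "indep_var borel f borel (\<lambda>\<omega>. \<Prod>i\<in>T. (B t \<omega> - B s \<omega>) $ i)" .
  note int = brownian_increment_prod_mean_zero(1)[OF bm st, of T]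
  show "integrable M (\<lambda>\<omega>. f \<omega> * (\<Prod>i\<in>T. (B t \<omega> - B s \<omega>) $ i))"
    by (rule indep_var_integrable[OF ind f(2) int])
  show "expectation (\<lambda>\<omega>. f \<omega> * (\<Prod>i\<in>T. (B t \<omega> - B s \<omega>) $ i)) = 0"
    using indep_var_lebesgue_integral[OF ind f(2) int] brownian_increment_prod_mean_zero(2)[OF bm st T] by simp
qed

text \<open>
  Expand the products in \<open>e\<^sub>k\<close>: each term other than the one free of increments contains
  a product of increments in distinct coordinates, which is independent of the past and has mean zero.
\<close>

lemma esym_plus_increment:
  assumes st: "0 \<le> s" "s < t" and A: "A \<in> sets (\<F> s)"
    and Y: "Y \<in> borel_measurable (\<F> s)" "integrable M (\<lambda>\<omega>. (1 + norm (Y \<omega>)) ^ CARD('n))"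
  shows "integrable M (\<lambda>\<omega>. indicator A \<omega> * esym k (Y \<omega> + c *\<^sub>R (B t \<omega> - B s \<omega>)))"
    and "expectation (\<lambda>\<omega>. indicator A \<omega> * esym k (Y \<omega> + c *\<^sub>R (B t \<omega> - B s \<omega>)))
       = expectation (\<lambda>\<omega>. indicator A \<omega> * esym k (Y \<omega>))"
proof -
  let ?\<Delta> = "\<lambda>\<omega>. B t \<omega> - B s \<omega>"
  define g where "g S T \<omega> = c ^ card T * ((indicator A \<omega> * (\<Prod>i\<in>S - T. Y \<omega> $ i)) * (\<Prod>i\<in>T. ?\<Delta> \<omega> $ i))" for S T \<omega>
  have expand: "indicator A \<omega> * esym k (Y \<omega> + c *\<^sub>R ?\<Delta> \<omega>) = (\<Sum>S | card S = k. \<Sum>T\<in>Pow S. g S T \<omega>)" for \<omega>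
  proof -
    have prods: "(\<Prod>i\<in>S. (Y \<omega> + c *\<^sub>R ?\<Delta> \<omega>) $ i) = (\<Sum>T\<in>Pow S. c ^ card T * (\<Prod>i\<in>T. ?\<Delta> \<omega> $ i) * (\<Prod>i\<in>S - T. Y \<omega> $ i))" for S :: "'n set"
    proof -
      have "(\<Prod>i\<in>S. (Y \<omega> + c *\<^sub>R ?\<Delta> \<omega>) $ i) = (\<Prod>i\<in>S. c * ?\<Delta> \<omega> $ i + Y \<omega> $ i)"
        by (simp add: add.commute)
      also have "\<dots> = (\<Sum>T\<in>Pow S. (\<Prod>i\<in>T. c * ?\<Delta> \<omega> $ i) * (\<Prod>i\<in>S - T. Y \<omega> $ i))"
        by (rule prod_add) simp
      finally show ?thesis by (simp add: prod.distrib)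
    qed
    show ?thesis by (simp only: esym_def g_def prods sum_distrib_left mult_ac)
  qed
  have base: "(\<lambda>\<omega>. indicator A \<omega> * (\<Prod>i\<in>R. Y \<omega> $ i)) \<in> borel_measurable (\<F> s)"
    "integrable M (\<lambda>\<omega>. indicator A \<omega> * (\<Prod>i\<in>R. Y \<omega> $ i))" for R
  proof -
    note [measurable] = A measurable_compose[OF Y(1) borel_measurable_nth]
    show m: "(\<lambda>\<omega>. indicator A \<omega> * (\<Prod>i\<in>R. Y \<omega> $ i)) \<in> borel_measurable (\<F> s)"
      by measurable
    show "integrable M (\<lambda>\<omega>. indicator A \<omega> * (\<Prod>i\<in>R. Y \<omega> $ i))"
    proof (rule Bochner_Integration.integrable_bound[OF Y(2)])
      show "AE \<omega> in M. norm (indicator A \<omega> * (\<Prod>i\<in>R. Y \<omega> $ i)) \<le> norm ((1 + norm (Y \<omega>)) ^ CARD('n))"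
      proof (rule AE_I2)
        fix \<omega>
        show "norm (indicator A \<omega> * (\<Prod>i\<in>R. Y \<omega> $ i)) \<le> norm ((1 + norm (Y \<omega>)) ^ CARD('n))"
          using abs_prod_vec_le[where v = "Y \<omega>" and S = R] by (cases "\<omega> \<in> A") auto
      qed
    qed (rule canonical_measurable[OF m])
  qed
  have g0: "g S {} \<omega> = indicator A \<omega> * (\<Prod>i\<in>S. Y \<omega> $ i)" for S \<omega> by (simp add: g_def)
  have int_g: "integrable M (g S T)" for S T
  proof (cases "T = {}")
    case True
    then show ?thesis using base(2)[of S] unfolding g0[abs_def, symmetric] by simp
  next
    case False
    then show ?thesis unfolding g_def by (intro integrable_mult_right expectation_times_increment_prod(1) st base)
  qed
  have E_g: "expectation (g S T) = 0" if "T \<noteq> {}" for S T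
    unfolding g_def using expectation_times_increment_prod(2)[OF st base that] by simp
  show "integrable M (\<lambda>\<omega>. indicator A \<omega> * esym k (Y \<omega> + c *\<^sub>R ?\<Delta> \<omega>))"
    unfolding expand by (intro Bochner_Integration.integrable_sum int_g)
  have "expectation (\<lambda>\<omega>. indicator A \<omega> * esym k (Y \<omega> + c *\<^sub>R ?\<Delta> \<omega>))
      = (\<Sum>S | card S = k. \<Sum>T\<in>Pow S. expectation (g S T))"
    unfolding expand
    by (simp only: Bochner_Integration.integral_sum int_g Bochner_Integration.integrable_sum)
  also have "\<dots> = (\<Sum>S | card S = k. expectation (g S {}))"
  proof (intro sum.cong refl)
    fix S :: "'n set"
    have "(\<Sum>T\<in>Pow S. expectation (g S T)) = (\<Sum>T\<in>{{}}. expectation (g S T))"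
      by (rule sum.mono_neutral_right) (auto intro: E_g)
    then show "(\<Sum>T\<in>Pow S. expectation (g S T)) = expectation (g S {})" by simp
  qed
  also have "\<dots> = expectation (\<lambda>\<omega>. indicator A \<omega> * esym k (Y \<omega>))"
    unfolding esym_def sum_distrib_left g0[abs_def]
    by (rule Bochner_Integration.integral_sum[symmetric]) (rule base)
  finally show "expectation (\<lambda>\<omega>. indicator A \<omega> * esym k (Y \<omega> + c *\<^sub>R ?\<Delta> \<omega>))
       = expectation (\<lambda>\<omega>. indicator A \<omega> * esym k (Y \<omega>))" .
qed

end


section \<open>Moments of the running maximum of Brownian motion\<close>

text \<open>
  A dyadic time of level \<open>n + 1\<close> is one step away from one of level \<open>n\<close>, so the distance from the origin
  is at most a geometric series of step sizes.
\<close>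

lemma dyadic_chaining:
  fixes g :: "real \<Rightarrow> 'v::real_normed_vector"
  assumes g0: "g 0 = 0" and \<rho>: "0 < \<rho>" "\<rho> < 1"
    and step: "\<And>n j. j < 2 ^ n \<Longrightarrow> norm (g (T * real (Suc j) / 2 ^ n) - g (T * real j / 2 ^ n)) \<le> \<rho> ^ n * r"
    and r: "0 \<le> r"
  shows "j \<le> 2 ^ n \<Longrightarrow> norm (g (T * real j / 2 ^ n)) \<le> r / (1 - \<rho>)"
proof -
  have "j \<le> 2 ^ n \<Longrightarrow> norm (g (T * real j / 2 ^ n)) \<le> (\<Sum>i\<le>n. \<rho> ^ i * r)" for n j
  proof (induction n arbitrary: j)
    case 0
    then consider "j = 0" | "j = 1" by (cases j) auto
    then show ?case using step[of 0 0] r g0 by cases auto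
  next
    case (Suc n)
    have half: "T * real (2 * i) / 2 ^ Suc n = T * real i / 2 ^ n" for i by simp
    show ?case
    proof (cases "even j")
      case True
      then obtain i where i: "j = 2 * i" by (elim evenE)
      then have "norm (g (T * real j / 2 ^ Suc n)) \<le> (\<Sum>i\<le>n. \<rho> ^ i * r)"
        using Suc.IH[of i] Suc.prems unfolding i half by simp
      also have "\<dots> \<le> (\<Sum>i\<le>Suc n. \<rho> ^ i * r)" using \<rho> r by simp
      finally show ?thesis .
    next
      case False
      then obtain i where i: "j = Suc (2 * i)" by (elim oddE) simp
      have lt: "2 * i < 2 ^ Suc n" using Suc.prems i by simp
      have "norm (g (T * real j / 2 ^ Suc n)) \<le> norm (g (T * real (2 * i) / 2 ^ Suc n))
          + norm (g (T * real (Suc (2 * i)) / 2 ^ Suc n) - g (T * real (2 * i) / 2 ^ Suc n))"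
        unfolding i by (metis add.commute diff_add_cancel norm_triangle_ineq)
      also have "\<dots> \<le> (\<Sum>i\<le>n. \<rho> ^ i * r) + \<rho> ^ Suc n * r"
        using Suc.IH[of i] lt unfolding half by (intro add_mono step[OF lt, unfolded half]) simp
      finally show ?thesis by simp
    qed
  qed
  moreover have "(\<Sum>i\<le>n. \<rho> ^ i * r) \<le> r / (1 - \<rho>)" for n
  proof -
    have "(\<Sum>i\<le>n. \<rho> ^ i) \<le> (\<Sum>i. \<rho> ^ i)" using \<rho> by (intro sum_le_suminf summable_geometric) auto
    also have "\<dots> = 1 / (1 - \<rho>)" using \<rho> by (intro suminf_geometric) auto
    finally have "(\<Sum>i\<le>n. \<rho> ^ i) * r \<le> 1 / (1 - \<rho>) * r" using r by (rule mult_right_mono)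
    then show ?thesis by (simp add: sum_distrib_right)
  qed
  ultimately show "j \<le> 2 ^ n \<Longrightarrow> norm (g (T * real j / 2 ^ n)) \<le> r / (1 - \<rho>)"
    by (meson order.trans)
qed

lemma dyadic_bound_extends:
  fixes g :: "real \<Rightarrow> 'v::real_normed_vector"
  assumes T: "0 < T" and cont: "continuous_on {0..T} g" and u: "u \<in> {0..T}"
    and bound: "\<And>n j. j \<le> 2 ^ n \<Longrightarrow> norm (g (T * real j / 2 ^ n)) \<le> K"
  shows "norm (g u) \<le> K"
proof -
  define j where "j n = nat \<lfloor>u * 2 ^ n / T\<rfloor>" for n :: nat
  have pos: "0 \<le> u * 2 ^ n / T" for n :: nat using u T by simp
  have j1: "real (j n) \<le> u * 2 ^ n / T" and j2: "u * 2 ^ n / T < real (j n) + 1" for n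
    using pos[of n] unfolding j_def by linarith+
  have le: "T * real (j n) / 2 ^ n \<le> u" for n
    using j1[of n] T by (simp add: field_simps)
  have ge: "u - T * real (j n) / 2 ^ n \<le> T / 2 ^ n" for n
  proof -
    have "u * 2 ^ n \<le> (real (j n) + 1) * T" using j2[of n] T by (simp add: pos_divide_less_eq)
    then have "u \<le> (real (j n) + 1) * T / 2 ^ n" by (simp add: pos_le_divide_eq)
    then show ?thesis by (simp add: add_divide_distrib algebra_simps)
  qed
  have "real (j n) \<le> 2 ^ n" for n
  proof -
    have "u * 2 ^ n / T \<le> 2 ^ n" using u T by (simp add: field_simps mult_right_mono)
    then show ?thesis using j1[of n] by linarith
  qed
  then have jn: "j n \<le> 2 ^ n" for n
    by (metis of_nat_le_iff of_nat_numeral of_nat_power)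
  have "(\<lambda>n. T / 2 ^ n) \<longlonglongrightarrow> 0"
    using tendsto_mult_right_zero[OF LIMSEQ_power_zero[of "1 / 2 :: real"], of T] by (simp add: power_divide)
  then have "(\<lambda>n. T * real (j n) / 2 ^ n - u) \<longlonglongrightarrow> 0"
  proof (rule Lim_null_comparison[rotated], intro always_eventually allI)
    show "norm (T * real (j n) / 2 ^ n - u) \<le> T / 2 ^ n" for n
      using le[of n] ge[of n] by simp
  qed
  then have lim: "(\<lambda>n. T * real (j n) / 2 ^ n) \<longlonglongrightarrow> u" by (rule LIM_zero_cancel)
  have mem: "T * real (j n) / 2 ^ n \<in> {0..T}" for n
    using T le[of n] u by (auto intro: order.trans)
  have "(\<lambda>n. g (T * real (j n) / 2 ^ n)) \<longlonglongrightarrow> g u"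
    by (rule continuous_on_tendsto_compose[OF cont lim u]) (simp add: mem[unfolded atLeastAtMost_iff])
  then show ?thesis
    by (rule tendsto_upperbound[OF tendsto_norm]) (auto intro!: always_eventually bound jn)
qed

lemma AE_summable_integrable_suminf:
  fixes f :: "nat \<Rightarrow> 'a \<Rightarrow> real"
  assumes int: "\<And>n. integrable M (f n)" and nonneg: "\<And>n \<omega>. 0 \<le> f n \<omega>"
    and sum: "summable (\<lambda>n. LINT \<omega>|M. f n \<omega>)"
  shows "AE \<omega> in M. summable (\<lambda>n. f n \<omega>)" and "integrable M (\<lambda>\<omega>. \<Sum>n. f n \<omega>)"
proof -
  have [measurable]: "f n \<in> borel_measurable M" for n using int[of n] by auto
  have "(\<integral>\<^sup>+\<omega>. (\<Sum>n. ennreal (f n \<omega>)) \<partial>M) = (\<Sum>n. \<integral>\<^sup>+\<omega>. ennreal (f n \<omega>) \<partial>M)"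
    by (rule nn_integral_suminf) measurable
  also have "\<dots> = (\<Sum>n. ennreal (LINT \<omega>|M. f n \<omega>))"
    using int nonneg by (intro suminf_cong nn_integral_eq_integral) auto
  also have "\<dots> = ennreal (\<Sum>n. LINT \<omega>|M. f n \<omega>)"
    using sum nonneg by (intro suminf_ennreal2) auto
  finally have "(\<integral>\<^sup>+\<omega>. (\<Sum>n. ennreal (f n \<omega>)) \<partial>M) \<noteq> \<infinity>" by simp
  then have "AE \<omega> in M. (\<Sum>n. ennreal (f n \<omega>)) \<noteq> \<infinity>"
    by (intro nn_integral_PInf_AE) measurable
  then show ae: "AE \<omega> in M. summable (\<lambda>n. f n \<omega>)"
    by eventually_elim (rule summable_suminf_not_top, use nonneg in auto)
  show "integrable M (\<lambda>\<omega>. \<Sum>n. f n \<omega>)"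
    using ae sum nonneg by (intro integrable_suminf int) auto
qed

text \<open>
  The random variable \<open>V\<close> collects the \<open>p\<close>-th powers of all dyadic increments, with weight \<open>2\<^sup>n\<close> at
  level \<open>n\<close>. Since \<open>2\<^sup>n\<close> increments have \<open>p\<close>-th moments of order \<open>2 ^ (- n p / 2)\<close>, it is integrable for
  \<open>p \<ge> 6\<close>; conversely each increment of level \<open>n\<close> is at most the \<open>p\<close>-th root of
  \<open>2 ^ (- n) V\<close>, so chaining bounds the supremum by a multiple of the \<open>p\<close>-th root of \<open>V\<close>.
\<close>

lemma brownian_sup_moment:
  fixes B :: "real \<Rightarrow> 'a \<Rightarrow> real ^ 'n::finite"
  assumes M: "prob_space M" and bm: "brownian_motion M B" and T: "0 < T"
  obtains U where "U \<in> borel_measurable M" "\<And>\<omega>. 0 \<le> U \<omega>" "integrable M (\<lambda>\<omega>. (1 + U \<omega>) ^ q)"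
    "AE \<omega> in M. \<forall>u\<in>{0..T}. norm (B u \<omega>) \<le> U \<omega>"
proof -
  interpret prob_space M by (rule M)
  \<comment> \<open>\<open>m \<ge> q\<close> for the requested moment, \<open>m \<ge> 3\<close> for summability over the dyadic levels.\<close>
  define m where "m = q + 3"
  define p where "p = 2 * m"
  have p: "0 < p" by (simp add: p_def m_def)
  obtain C where C: "C \<ge> 0"
    "\<And>s t. 0 \<le> s \<Longrightarrow> s < t \<Longrightarrow> integrable M (\<lambda>\<omega>. norm (B t \<omega> - B s \<omega>) ^ p)"
    "\<And>s t. 0 \<le> s \<Longrightarrow> s < t \<Longrightarrow> expectation (\<lambda>\<omega>. norm (B t \<omega> - B s \<omega>) ^ p) \<le> C * (t - s) ^ m"
    using brownian_increment_moment[OF bm, of m] unfolding p_def by blast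
  define \<Delta> where "\<Delta> n j \<omega> = norm (B (T * real (Suc j) / 2 ^ n) \<omega> - B (T * real j / 2 ^ n) \<omega>)" for n j \<omega>
  define f where "f n \<omega> = 2 ^ n * (\<Sum>j<2 ^ n. \<Delta> n j \<omega> ^ p)" for n :: nat and \<omega>
  \<comment> \<open>The absolute value only matters where the series diverges, on a null set.\<close>
  define V where "V \<omega> = \<bar>\<Sum>n. f n \<omega>\<bar>" for \<omega>
  have lt: "T * real j / 2 ^ n < T * real (Suc j) / 2 ^ n" for j n :: nat
    using T by (intro divide_strict_right_mono mult_strict_left_mono) auto
  have nn: "0 \<le> T * real j / 2 ^ n" for j n :: nat using T by simp
  have diff: "T * real (Suc j) / 2 ^ n - T * real j / 2 ^ n = T / 2 ^ n" for j n :: nat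
    by (simp add: field_simps)
  have int_\<Delta>: "integrable M (\<lambda>\<omega>. \<Delta> n j \<omega> ^ p)" and E_\<Delta>: "expectation (\<lambda>\<omega>. \<Delta> n j \<omega> ^ p) \<le> C * (T / 2 ^ n) ^ m" for n j
    using C(2)[OF nn lt, of j n] C(3)[OF nn lt, of j n] unfolding \<Delta>_def diff by auto
  have \<Delta>_nn: "0 \<le> \<Delta> n j \<omega>" for n j \<omega> by (simp add: \<Delta>_def)
  have f_nn: "0 \<le> f n \<omega>" for n \<omega> unfolding f_def by (intro mult_nonneg_nonneg sum_nonneg) (auto simp: \<Delta>_nn)
  have int_f: "integrable M (f n)" for n
    unfolding f_def by (intro integrable_mult_right Bochner_Integration.integrable_sum int_\<Delta>)
  have E_f: "expectation (f n) \<le> (C * T ^ m) * (1 / 2) ^ n" for n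
  proof -
    have "expectation (f n) = 2 ^ n * (\<Sum>j<2 ^ n. expectation (\<lambda>\<omega>. \<Delta> n j \<omega> ^ p))"
      unfolding f_def by (simp only: integral_mult_right_zero Bochner_Integration.integral_sum[OF int_\<Delta>])
    also have "\<dots> \<le> 2 ^ n * (\<Sum>j<(2 :: nat) ^ n. C * (T / 2 ^ n) ^ m)"
      by (intro mult_left_mono sum_mono E_\<Delta>) auto
    also have "\<dots> = (C * T ^ m) * ((2 ^ n * 2 ^ n) / (2 ^ n) ^ m)"
      by (simp add: power_divide)
    also have "\<dots> \<le> (C * T ^ m) * (1 / 2) ^ n"
    proof (rule mult_left_mono)
      have "(2 ^ n) ^ 3 \<le> ((2 ^ n) ^ m :: real)" by (intro power_increasing) (auto simp: m_def)
      then have "(2 ^ n * 2 ^ n) / (2 ^ n) ^ m \<le> (2 ^ n * 2 ^ n) / ((2 ^ n) ^ 3 :: real)"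
        by (intro divide_left_mono) auto
      also have "\<dots> = (1 / 2) ^ n" by (simp add: power3_eq_cube power_divide)
      finally show "(2 ^ n * 2 ^ n) / (2 ^ n) ^ m \<le> ((1 / 2) ^ n :: real)" .
      show "0 \<le> C * T ^ m" using C(1) T by simp
    qed
    finally show ?thesis .
  qed
  have "summable (\<lambda>n. expectation (f n))"
  proof (rule summable_comparison_test)
    show "summable (\<lambda>n. (C * T ^ m) * (1 / 2) ^ n)" by (intro summable_mult summable_geometric) auto
    show "\<exists>N. \<forall>n\<ge>N. norm (expectation (f n)) \<le> (C * T ^ m) * (1 / 2) ^ n"
      using E_f f_nn by (intro exI[of _ 0]) (simp add: integral_nonneg)
  qed
  from AE_summable_integrable_suminf[of M f, OF int_f f_nn this]
  have ae_sum: "AE \<omega> in M. summable (\<lambda>n. f n \<omega>)" and int_V: "integrable M V"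
    unfolding V_def by (auto intro: integrable_abs)
  have V_nn: "0 \<le> V \<omega>" for \<omega> by (simp add: V_def)
  define \<rho> where "\<rho> = root p (1 / 2)"
  have \<rho>: "0 < \<rho>" "\<rho> < 1" using p by (simp_all add: \<rho>_def)
  have \<rho>p: "\<rho> ^ p = 1 / 2" using p by (simp add: \<rho>_def)
  define U where "U \<omega> = root p (V \<omega>) / (1 - \<rho>)" for \<omega>
  have U_nn: "0 \<le> U \<omega>" for \<omega> using \<rho> p V_nn[of \<omega>] by (simp add: U_def)
  have U_p: "U \<omega> ^ p = V \<omega> / (1 - \<rho>) ^ p" for \<omega>
    using p V_nn[of \<omega>] by (simp add: U_def power_divide)
  have meas: "U \<in> borel_measurable M"
    using borel_measurable_integrable[OF int_V] unfolding U_def by measurable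
  have int_U: "integrable M (\<lambda>\<omega>. (1 + U \<omega>) ^ q)"
  proof (rule Bochner_Integration.integrable_bound)
    show "integrable M (\<lambda>\<omega>. 2 ^ p * (1 + U \<omega> ^ p))"
      unfolding U_p using int_V by (intro integrable_mult_right Bochner_Integration.integrable_add integrable_divide) auto
    show "(\<lambda>\<omega>. (1 + U \<omega>) ^ q) \<in> borel_measurable M" using meas by measurable
    show "AE \<omega> in M. norm ((1 + U \<omega>) ^ q) \<le> norm (2 ^ p * (1 + U \<omega> ^ p))"
    proof (rule AE_I2)
      fix \<omega>
      have "(1 + U \<omega>) ^ q \<le> (1 + U \<omega>) ^ p" using U_nn[of \<omega>] by (intro power_increasing) (auto simp: p_def m_def)
      also have "\<dots> \<le> (2 * max 1 (U \<omega>)) ^ p" using U_nn[of \<omega>] by (intro power_mono) auto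
      also have "\<dots> = 2 ^ p * max 1 (U \<omega>) ^ p" by (simp add: power_mult_distrib)
      also have "max 1 (U \<omega>) ^ p \<le> 1 + U \<omega> ^ p" using U_nn[of \<omega>] by (auto simp: max_def)
      finally show "norm ((1 + U \<omega>) ^ q) \<le> norm (2 ^ p * (1 + U \<omega> ^ p))"
        using U_nn[of \<omega>] by simp
    qed
  qed
  have "AE \<omega> in M. B 0 \<omega> = 0" "AE \<omega> in M. continuous_on {0..} (\<lambda>t. B t \<omega>)"
    using bm by (auto simp: brownian_motion_def)
  then have "AE \<omega> in M. \<forall>u\<in>{0..T}. norm (B u \<omega>) \<le> U \<omega>"
    using ae_sum
  proof eventually_elim
    fix \<omega> assume B0: "B 0 \<omega> = 0" and cont: "continuous_on {0..} (\<lambda>t. B t \<omega>)" and sm: "summable (\<lambda>n. f n \<omega>)"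
    have step: "\<Delta> n j \<omega> \<le> \<rho> ^ n * root p (V \<omega>)" if j: "j < 2 ^ n" for n j
    proof -
      have "2 ^ n * \<Delta> n j \<omega> ^ p \<le> f n \<omega>"
        unfolding f_def using j by (intro mult_left_mono member_le_sum) (auto simp: \<Delta>_nn)
      also have "\<dots> \<le> (\<Sum>n. f n \<omega>)"
        using sum_le_suminf[OF sm, of "{n}"] f_nn by simp
      also have "\<dots> \<le> V \<omega>" by (simp add: V_def)
      finally have "\<Delta> n j \<omega> ^ p \<le> (1 / 2) ^ n * V \<omega>" by (simp add: field_simps power_divide)
      also have "\<dots> = (\<rho> ^ n * root p (V \<omega>)) ^ p"
      proof -
        have "(\<rho> ^ n) ^ p = (\<rho> ^ p) ^ n" by (simp only: power_mult[symmetric] mult.commute)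
        moreover have "root p (V \<omega>) ^ p = V \<omega>" using p V_nn[of \<omega>] by simp
        ultimately show ?thesis by (simp only: power_mult_distrib \<rho>p)
      qed
      finally have "\<Delta> n j \<omega> ^ p \<le> (\<rho> ^ n * root p (V \<omega>)) ^ p" .
      moreover have "0 \<le> \<rho> ^ n * root p (V \<omega>)" using p \<rho> V_nn[of \<omega>] by simp
      ultimately show ?thesis using p \<Delta>_nn[of n j \<omega>] by (simp only: power_mono_iff)
    qed
    show "\<forall>u\<in>{0..T}. norm (B u \<omega>) \<le> U \<omega>"
    proof
      fix u assume u: "u \<in> {0..T}"
      show "norm (B u \<omega>) \<le> U \<omega>"
      proof (rule dyadic_bound_extends[OF T _ u])
        show "continuous_on {0..T} (\<lambda>u. B u \<omega>)" using cont by (rule continuous_on_subset) auto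
        show "norm (B (T * real j / 2 ^ n) \<omega>) \<le> U \<omega>" if "j \<le> 2 ^ n" for n j
          unfolding U_def
          by (rule dyadic_chaining[of "\<lambda>u. B u \<omega>", OF B0 \<rho> _ _ that])
             (use step V_nn in \<open>auto simp: \<Delta>_def real_root_ge_zero\<close>)
      qed
    qed
  qed
  with meas U_nn int_U that show thesis by blast
qed


section \<open>The martingale property\<close>

lemma integral_Pair:
  fixes f :: "'a \<Rightarrow> 'v::euclidean_space" and g :: "'a \<Rightarrow> 'w::euclidean_space"
  assumes f: "integrable M f" and g: "integrable M g"
  shows "integrable M (\<lambda>r. (f r, g r))" and "(LINT r|M. (f r, g r)) = (LINT r|M. f r, LINT r|M. g r)"
proof -
  have lin: "bounded_linear (\<lambda>a :: 'v. (a, 0 :: 'w))" "bounded_linear (\<lambda>b :: 'w. (0 :: 'v, b))"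
    by (auto intro!: bounded_linear_Pair bounded_linear_ident bounded_linear_zero)
  have "integrable M (\<lambda>r. (f r, 0) + (0, g r))"
    by (intro Bochner_Integration.integrable_add integrable_bounded_linear[OF lin(1) f] integrable_bounded_linear[OF lin(2) g])
  then show int: "integrable M (\<lambda>r. (f r, g r))" by simp
  show "(LINT r|M. (f r, g r)) = (LINT r|M. f r, LINT r|M. g r)"
    using integral_bounded_linear[OF bounded_linear_fst int] integral_bounded_linear[OF bounded_linear_snd int]
    by (simp add: prod_eq_iff)
qed

context drift_path
begin

text \<open>
  Time is adjoined as a coordinate of finite variation, so that the chain rule covers
  functions of time and space.
\<close>

lemma heat_path:
  assumes s: "0 \<le> s" "s \<le> T"
  shows "finite_variation_path (heat_poly k) (heat_gradient k)
    (\<lambda>u. (u, y u)) (\<lambda>u. (0, w u)) (\<lambda>u. (1, drift_vec (x u))) s T"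
proof
  have sub: "{s..T} \<subseteq> {0..T}" using s by auto
  have one: "set_integrable lborel {s..T} (\<lambda>_. 1 :: real)"
    by (rule borel_integrable_atLeastAtMost') auto
  have D: "set_integrable lborel {s..T} (\<lambda>u. drift_vec (x u))"
    by (rule set_integrable_subset[OF drift_vec_int]) (use sub in auto)
  show "s \<le> T" by (rule s)
  show "set_integrable lborel {s..T} (\<lambda>u. (1 :: real, drift_vec (x u)))"
    using integral_Pair(1)[OF one[unfolded set_integrable_def] D[unfolded set_integrable_def]]
    unfolding set_integrable_def by simp
  show "(b, y b) - (a, y a) = (LBINT r:{a<..b}. (1, drift_vec (x r)))"
    if ab: "s \<le> a" "a \<le> b" "b \<le> T" for a b
  proof -
    have "{a<..b} \<subseteq> {s..T}" using ab by auto
    then have "set_integrable lborel {a<..b} (\<lambda>_. 1 :: real)" "set_integrable lborel {a<..b} (\<lambda>u. drift_vec (x u))"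
      using set_integrable_subset[OF one, of "{a<..b}"] set_integrable_subset[OF D, of "{a<..b}"] by auto
    from integral_Pair(2)[OF this[unfolded set_integrable_def]]
    have "(LBINT r:{a<..b}. (1 :: real, drift_vec (x r))) = (b - a, LBINT r:{a<..b}. drift_vec (x r))"
      using ab by (simp add: set_lebesgue_integral_def)
    then show ?thesis using y_diff[of a b] ab s by simp
  qed
  show "continuous_on {s..T} (\<lambda>u. (u, y u))" "continuous_on {s..T} (\<lambda>u. (0 :: real, w u))"
    using continuous_on_subset[OF cont_y sub] continuous_on_subset[OF cont_w sub]
    by (auto intro!: continuous_intros)
qed

definition heat_sum :: "nat \<Rightarrow> real \<Rightarrow> nat \<Rightarrow> real" where
  "heat_sum k s n = (\<Sum>j\<le>n. heat_poly k (mesh s T n (Suc j), x (mesh s T n (Suc j)))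
     - heat_poly k (mesh s T n j, x (mesh s T n j) + (w (mesh s T n (Suc j)) - w (mesh s T n j))))"

lemma heat_sum_eq_riemann_sum:
  assumes s: "0 \<le> s" "s \<le> T"
  shows "heat_sum k s = finite_variation_path.riemann_sum (heat_poly k) (\<lambda>u. (u, y u)) (\<lambda>u. (0, w u)) s T"
proof
  fix n
  show "heat_sum k s n = finite_variation_path.riemann_sum (heat_poly k) (\<lambda>u. (u, y u)) (\<lambda>u. (0, w u)) s T n"
    unfolding heat_sum_def finite_variation_path.riemann_sum_def[OF heat_path[OF s]]
    by (simp add: y_def algebra_simps)
qed

text \<open>
  The limiting integrand vanishes at each time at which the particles do not collide, hence at
  almost every time.
\<close>

lemma heat_sum_tendsto_0:
  assumes s: "0 \<le> s" "s \<le> T" and k: "k \<le> CARD('n)"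
  shows "heat_sum k s \<longlonglongrightarrow> 0"
proof -
  have "(LBINT r:{s..T}. heat_gradient k ((r, y r) + (0, w r)) \<bullet> (1, drift_vec (x r))) = 0"
    unfolding set_lebesgue_integral_def
  proof (rule integral_eq_zero_AE)
    show "AE r in lborel. indicator {s..T} r *\<^sub>R (heat_gradient k ((r, y r) + (0, w r)) \<bullet> (1, drift_vec (x r))) = 0"
      using distinct
    proof eventually_elim
      fix r assume d: "r \<in> {0..T} \<longrightarrow> (\<forall>i j. i \<noteq> j \<longrightarrow> x r $ i \<noteq> x r $ j)"
      show "indicator {s..T} r *\<^sub>R (heat_gradient k ((r, y r) + (0, w r)) \<bullet> (1, drift_vec (x r))) = 0"
      proof (cases "r \<in> {s..T}")
        case True
        then have "heat_gradient k (r, x r) \<bullet> (1, drift_vec (x r)) = 0"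
          unfolding drift_vec_def using d s by (intro heat_gradient_drift k) auto
        then show ?thesis by (simp add: y_def)
      qed simp
    qed
  qed
  then show ?thesis
    using finite_variation_path.riemann_sum_tendsto[OF heat_path[OF s, of k]]
    unfolding heat_sum_eq_riemann_sum[OF s] by simp
qed

lemma bound_const_ge_1: "1 \<le> bound_const"
  using T unfolding bound_const_def by simp

lemma heat_sum_bound:
  assumes s: "0 \<le> s" "s \<le> T"
    and C: "\<And>z :: real \<times> (real ^ 'n::{finite,linorder}). norm (heat_gradient k z) \<le> C * (1 + norm z) ^ q" "0 \<le> C"
    and b: "\<And>u. u \<in> {0..T} \<Longrightarrow> norm (w u) \<le> b"
  shows "\<bar>heat_sum k s n\<bar> \<le> C * (1 + 2 * (T + bound_const * (1 + b))) ^ q * (T + (bound_const * (1 + b))\<^sup>2)"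
proof -
  let ?R = "T + bound_const * (1 + b)"
  have sub: "{s..T} \<subseteq> {0..T}" using s by auto
  have "0 \<le> norm (w 0)" "norm (w 0) \<le> b" using b[of 0] T by auto
  then have b0: "0 \<le> b" by linarith
  have R0: "0 \<le> ?R" using T b0 bound_const_ge_1 by simp
  have D: "set_integrable lborel {s..T} (\<lambda>u. norm (drift_vec (x u)))"
    by (intro set_integrable_norm set_integrable_subset[OF drift_vec_int]) (use sub in auto)
  have one: "set_integrable lborel {s..T} (\<lambda>_. 1 :: real)"
    by (rule borel_integrable_atLeastAtMost') auto
  have "\<bar>heat_sum k s n\<bar> \<le> (C * (1 + 2 * ?R) ^ q) * (LBINT r:{s..T}. norm (1 :: real, drift_vec (x r)))"
    unfolding heat_sum_eq_riemann_sum[OF s]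
  proof (rule finite_variation_path.riemann_sum_bound[OF heat_path[OF s]])
    fix r assume "r \<in> {s..T}"
    then have r: "r \<in> {0..T}" using sub by auto
    have "norm (r, y r) \<le> norm r + norm (y r)" by (rule norm_Pair_le)
    then show "norm (r, y r) + norm (0 :: real, w r) \<le> ?R"
      using a_priori_bounds(1)[OF b r] r by (simp add: norm_Pair)
  next
    fix z :: "real \<times> (real ^ 'n::{finite,linorder})" assume z: "norm z \<le> 2 * ?R"
    have "norm (heat_gradient k z) \<le> C * (1 + norm z) ^ q" by (rule C)
    also have "\<dots> \<le> C * (1 + 2 * ?R) ^ q" using z C(2) by (intro mult_left_mono power_mono) auto
    finally show "norm (heat_gradient k z) \<le> C * (1 + 2 * ?R) ^ q" .
  qed
  also have "(LBINT r:{s..T}. norm (1 :: real, drift_vec (x r))) \<le> (LBINT r:{s..T}. 1 + norm (drift_vec (x r)))"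
  proof (rule set_integral_mono)
    show "set_integrable lborel {s..T} (\<lambda>r. norm (1 :: real, drift_vec (x r)))"
      using finite_variation_path.d_int[OF heat_path[OF s]] by (rule set_integrable_norm)
    show "norm (1 :: real, drift_vec (x r)) \<le> 1 + norm (drift_vec (x r))" for r
      using norm_Pair_le[of "1 :: real" "drift_vec (x r)"] by simp
  qed (rule set_integral_add(1)[OF one D])
  also have "\<dots> = (T - s) + (LBINT r:{s..T}. norm (drift_vec (x r)))"
    unfolding set_integral_add(2)[OF one D] using s by (simp add: set_lebesgue_integral_def)
  also have "\<dots> \<le> T + (LBINT r:{0..T}. norm (drift_vec (x r)))"
  proof (rule add_mono)
    show "(LBINT r:{s..T}. norm (drift_vec (x r))) \<le> (LBINT r:{0..T}. norm (drift_vec (x r)))"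
      using sub D set_integrable_norm[OF drift_vec_int] unfolding set_lebesgue_integral_def set_integrable_def
      by (intro integral_mono) (auto simp: indicator_def)
  qed (use s in simp)
  also have "\<dots> \<le> T + (bound_const * (1 + b))\<^sup>2"
    using a_priori_bounds(2)[OF b] by simp
  finally show ?thesis using C(2) R0 by (simp add: mult_left_mono)
qed

end

lemma drift_A_scaleR:
  fixes x :: "real ^ 'n::finite"
  shows "drift_A i (c *\<^sub>R x) = drift_A i x / c"
proof -
  have "1 / (c * x $ i - c * x $ j) = 1 / (x $ i - x $ j) / c" for j
    by (simp add: right_diff_distrib[symmetric] divide_simps)
  then show ?thesis by (simp add: drift_A_def sum_divide_distrib)
qed

lemma continuous_on_heat_poly: "continuous_on A (heat_poly k)"
  unfolding heat_poly_def
  by (intro continuous_intros continuous_on_compose2[OF continuous_on_esym[of UNIV]]) auto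

context brownian
begin

lemma integrable_indicator_esym:
  fixes Y :: "'a \<Rightarrow> real ^ 'n"
  assumes s: "0 \<le> s" and A: "A \<in> sets (\<F> s)"
    and Y: "Y \<in> borel_measurable (\<F> s)" "integrable M (\<lambda>\<omega>. (1 + norm (Y \<omega>)) ^ CARD('n))"
  shows "integrable M (\<lambda>\<omega>. indicator A \<omega> * esym k (Y \<omega>))"
  using esym_plus_increment(1)[of s "s + 1" A Y k 0] s A Y by simp

lemma heat_poly_plus_increment:
  assumes st: "0 \<le> s" "s < t" and A: "A \<in> sets (\<F> s)"
    and Y: "Y \<in> borel_measurable (\<F> s)" "integrable M (\<lambda>\<omega>. (1 + norm (Y \<omega>)) ^ CARD('n))"
  shows "integrable M (\<lambda>\<omega>. indicator A \<omega> * heat_poly k (u, Y \<omega> + c *\<^sub>R (B t \<omega> - B s \<omega>)))"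
    and "integrable M (\<lambda>\<omega>. indicator A \<omega> * heat_poly k (u, Y \<omega>))"
    and "expectation (\<lambda>\<omega>. indicator A \<omega> * heat_poly k (u, Y \<omega> + c *\<^sub>R (B t \<omega> - B s \<omega>)))
       = expectation (\<lambda>\<omega>. indicator A \<omega> * heat_poly k (u, Y \<omega>))"
proof -
  have eq: "indicator A \<omega> * heat_poly k (u, v) = (\<Sum>l\<le>k div 2. (heat_coeff CARD('n) k l * u ^ l) * (indicator A \<omega> * esym (k - 2 * l) v))"
    for \<omega> and v :: "real ^ 'n"
    by (simp add: heat_poly_def sum_distrib_left mult_ac)
  note int = esym_plus_increment(1)[OF st A Y] integrable_indicator_esym[OF st(1) A Y]
  show "integrable M (\<lambda>\<omega>. indicator A \<omega> * heat_poly k (u, Y \<omega> + c *\<^sub>R (B t \<omega> - B s \<omega>)))"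
    "integrable M (\<lambda>\<omega>. indicator A \<omega> * heat_poly k (u, Y \<omega>))"
    unfolding eq by (intro Bochner_Integration.integrable_sum integrable_mult_right int)+
  show "expectation (\<lambda>\<omega>. indicator A \<omega> * heat_poly k (u, Y \<omega> + c *\<^sub>R (B t \<omega> - B s \<omega>)))
       = expectation (\<lambda>\<omega>. indicator A \<omega> * heat_poly k (u, Y \<omega>))"
    unfolding eq
    by (simp only: Bochner_Integration.integral_sum[OF integrable_mult_right[OF int(1)]]
        Bochner_Integration.integral_sum[OF integrable_mult_right[OF int(2)]]
        integral_mult_right_zero esym_plus_increment(2)[OF st A Y])
qed

end

locale renormalized_bessel = brownian M B
  for M :: "'a measure" and B :: "real \<Rightarrow> 'a \<Rightarrow> real ^ 'n::{finite,linorder}" +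
  fixes X :: "real \<Rightarrow> 'a \<Rightarrow> real ^ 'n::{finite,linorder}" and \<beta> :: real and x\<^sub>0 :: "real ^ 'n::{finite,linorder}"
  assumes \<beta>: "0 < \<beta>" and bessel: "bessel_process_A M B \<beta> (sqrt \<beta> *\<^sub>R x\<^sub>0) X"
begin

abbreviation "Y \<equiv> renormalize \<beta> X"

definition c :: real where "c = 1 / sqrt \<beta>"

lemma c_pos: "0 < c" using \<beta> by (simp add: c_def)

lemma Y_eq: "Y t \<omega> = c *\<^sub>R X t \<omega>" by (simp add: renormalize_def c_def)

lemma measurable_Y: "0 \<le> t \<Longrightarrow> Y t \<in> borel_measurable (\<F> t)"
  unfolding Y_eq[abs_def] using bessel by (auto simp: bessel_process_A_def)

text \<open>
  The drift is homogeneous of degree \<open>-1\<close>, so division by \<open>sqrt \<beta>\<close> moves the factor \<open>\<beta>\<close> from the drift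
  to the noise.
\<close>

lemma AE_drift_path: "AE \<omega> in M. \<forall>T\<ge>0. drift_path (\<lambda>t. Y t \<omega>) (\<lambda>t. c *\<^sub>R B t \<omega>) x\<^sub>0 T"
proof -
  have "AE \<omega> in M. continuous_on {0..} (\<lambda>t. X t \<omega>)"
    "AE \<omega> in M. \<forall>t\<ge>0. X t \<omega> \<in> chamber_A"
    "AE \<omega> in M. AE s in lborel. 0 \<le> s \<longrightarrow> (\<forall>i j. i \<noteq> j \<longrightarrow> X s \<omega> $ i \<noteq> X s \<omega> $ j)"
    "AE \<omega> in M. \<forall>t\<ge>0. \<forall>i. set_integrable lborel {0..t} (\<lambda>s. drift_A i (X s \<omega>)) \<and>
        X t \<omega> $ i = (sqrt \<beta> *\<^sub>R x\<^sub>0) $ i + B t \<omega> $ i + \<beta> * (LBINT s:{0..t}. drift_A i (X s \<omega>))"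
    using bessel by (simp_all add: bessel_process_A_def)
  moreover have "AE \<omega> in M. continuous_on {0..} (\<lambda>t. B t \<omega>)" using bm by (simp add: brownian_motion_def)
  ultimately show ?thesis
  proof eventually_elim
    fix \<omega>
    assume contX: "continuous_on {0..} (\<lambda>t. X t \<omega>)" and ch: "\<forall>t\<ge>0. X t \<omega> \<in> chamber_A"
      and dist: "AE s in lborel. 0 \<le> s \<longrightarrow> (\<forall>i j. i \<noteq> j \<longrightarrow> X s \<omega> $ i \<noteq> X s \<omega> $ j)"
      and eq: "\<forall>t\<ge>0. \<forall>i. set_integrable lborel {0..t} (\<lambda>s. drift_A i (X s \<omega>)) \<and>
        X t \<omega> $ i = (sqrt \<beta> *\<^sub>R x\<^sub>0) $ i + B t \<omega> $ i + \<beta> * (LBINT s:{0..t}. drift_A i (X s \<omega>))"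
      and contB: "continuous_on {0..} (\<lambda>t. B t \<omega>)"
    have dr: "drift_A i (Y s \<omega>) = sqrt \<beta> * drift_A i (X s \<omega>)" for i s
      by (simp add: Y_eq drift_A_scaleR c_def)
    show "\<forall>T\<ge>0. drift_path (\<lambda>t. Y t \<omega>) (\<lambda>t. c *\<^sub>R B t \<omega>) x\<^sub>0 T"
    proof (intro allI impI)
      fix T :: real assume T: "0 \<le> T"
      show "drift_path (\<lambda>t. Y t \<omega>) (\<lambda>t. c *\<^sub>R B t \<omega>) x\<^sub>0 T"
      proof
        show "0 \<le> T" by (rule T)
        show "continuous_on {0..T} (\<lambda>t. c *\<^sub>R B t \<omega>)" "continuous_on {0..T} (\<lambda>t. Y t \<omega>)"
          unfolding Y_eq using continuous_on_subset[OF contX, of "{0..T}"] continuous_on_subset[OF contB, of "{0..T}"]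
          by (auto intro!: continuous_intros)
        show "Y u \<omega> \<in> chamber_A" if "u \<in> {0..T}" for u
          using ch that c_pos by (auto simp: Y_eq chamber_A_def)
        show "AE u in lborel. u \<in> {0..T} \<longrightarrow> (\<forall>i j. i \<noteq> j \<longrightarrow> Y u \<omega> $ i \<noteq> Y u \<omega> $ j)"
          using dist by eventually_elim (use c_pos in \<open>auto simp: Y_eq\<close>)
        show "set_integrable lborel {0..T} (\<lambda>u. drift_A i (Y u \<omega>))" for i
          unfolding dr using eq T by (intro set_integrable_mult_right) auto
        show "Y u \<omega> $ i = x\<^sub>0 $ i + (c *\<^sub>R B u \<omega>) $ i + (LBINT r:{0..u}. drift_A i (Y r \<omega>))"
          if "u \<in> {0..T}" for u i
        proof -
          have X: "X u \<omega> $ i = sqrt \<beta> * x\<^sub>0 $ i + B u \<omega> $ i + \<beta> * (LBINT s:{0..u}. drift_A i (X s \<omega>))"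
            using eq that by simp
          have sq: "\<beta> = sqrt \<beta> * sqrt \<beta>" using \<beta> by simp
          have "c * \<beta> = sqrt \<beta>" "c * sqrt \<beta> = 1" using \<beta> by (simp_all add: c_def real_div_sqrt)
          then have "c * X u \<omega> $ i = x\<^sub>0 $ i + c * B u \<omega> $ i + sqrt \<beta> * (LBINT s:{0..u}. drift_A i (X s \<omega>))"
            unfolding X distrib_left mult.assoc[symmetric] by simp
          then show ?thesis unfolding dr by (simp add: Y_eq)
        qed
      qed
    qed
  qed
qed

lemma dominating_variable:
  assumes T: "0 < T"
  obtains U where "U \<in> borel_measurable M" "\<And>\<omega>. 0 \<le> U \<omega>" "integrable M (\<lambda>\<omega>. (1 + U \<omega>) ^ q)"
    "AE \<omega> in M. drift_path (\<lambda>t. Y t \<omega>) (\<lambda>t. c *\<^sub>R B t \<omega>) x\<^sub>0 T \<and> (\<forall>u\<in>{0..T}. norm (c *\<^sub>R B u \<omega>) \<le> c * U \<omega>)"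
proof -
  obtain U where U: "U \<in> borel_measurable M" "\<And>\<omega>. 0 \<le> U \<omega>" "integrable M (\<lambda>\<omega>. (1 + U \<omega>) ^ q)"
    "AE \<omega> in M. \<forall>u\<in>{0..T}. norm (B u \<omega>) \<le> U \<omega>"
    using brownian_sup_moment[OF prob_space_axioms bm T] by blast
  have "AE \<omega> in M. drift_path (\<lambda>t. Y t \<omega>) (\<lambda>t. c *\<^sub>R B t \<omega>) x\<^sub>0 T \<and> (\<forall>u\<in>{0..T}. norm (c *\<^sub>R B u \<omega>) \<le> c * U \<omega>)"
    using AE_drift_path U(4) by eventually_elim (use T c_pos in auto)
  with U that show thesis by blast
qed

lemma integrable_Y_moment:
  assumes t: "0 \<le> t" shows "integrable M (\<lambda>\<omega>. (1 + norm (Y t \<omega>)) ^ q)"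
proof -
  \<comment> \<open>A horizon beyond \<open>t\<close> is positive even for \<open>t = 0\<close>.\<close>
  let ?T = "t + 1" and ?K = "drift_path.bound_const x\<^sub>0 (t + 1)"
  have T: "0 < ?T" using t by simp
  obtain U where U: "U \<in> borel_measurable M" "\<And>\<omega>. 0 \<le> U \<omega>" "integrable M (\<lambda>\<omega>. (1 + U \<omega>) ^ q)"
    "AE \<omega> in M. drift_path (\<lambda>t. Y t \<omega>) (\<lambda>t. c *\<^sub>R B t \<omega>) x\<^sub>0 ?T \<and> (\<forall>u\<in>{0..?T}. norm (c *\<^sub>R B u \<omega>) \<le> c * U \<omega>)"
    by (rule dominating_variable[OF T, of q]) (rule that)
  have [measurable]: "Y t \<in> borel_measurable M" by (rule canonical_measurable[OF measurable_Y[OF t]])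
  show ?thesis
  proof (rule Bochner_Integration.integrable_bound)
    show "integrable M (\<lambda>\<omega>. (1 + ?K * (1 + c)) ^ q * (1 + U \<omega>) ^ q)"
      using U(3) by (rule integrable_mult_right)
    show "(\<lambda>\<omega>. (1 + norm (Y t \<omega>)) ^ q) \<in> borel_measurable M" by measurable
    show "AE \<omega> in M. norm ((1 + norm (Y t \<omega>)) ^ q) \<le> norm ((1 + ?K * (1 + c)) ^ q * (1 + U \<omega>) ^ q)"
      using U(4)
    proof eventually_elim
      fix \<omega> assume \<omega>: "drift_path (\<lambda>t. Y t \<omega>) (\<lambda>t. c *\<^sub>R B t \<omega>) x\<^sub>0 ?T \<and> (\<forall>u\<in>{0..?T}. norm (c *\<^sub>R B u \<omega>) \<le> c * U \<omega>)"
      interpret drift_path "\<lambda>t. Y t \<omega>" "\<lambda>t. c *\<^sub>R B t \<omega>" x\<^sub>0 ?T using \<omega> by simp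
      have "norm (y t) + norm (c *\<^sub>R B t \<omega>) \<le> bound_const * (1 + c * U \<omega>)"
        by (rule a_priori_bounds(1)) (use \<omega> t in auto)
      moreover have "norm (Y t \<omega>) \<le> norm (y t) + norm (c *\<^sub>R B t \<omega>)"
        using norm_triangle_ineq[of "y t" "c *\<^sub>R B t \<omega>"] by (simp add: y_def)
      moreover have "bound_const * (1 + c * U \<omega>) \<le> bound_const * ((1 + c) * (1 + U \<omega>))"
        using bound_const_ge_1 c_pos U(2)[of \<omega>] by (intro mult_left_mono) (auto simp: algebra_simps)
      ultimately have "1 + norm (Y t \<omega>) \<le> (1 + bound_const * (1 + c)) * (1 + U \<omega>)"
        using U(2)[of \<omega>] by (simp add: algebra_simps)
      then have "(1 + norm (Y t \<omega>)) ^ q \<le> ((1 + bound_const * (1 + c)) * (1 + U \<omega>)) ^ q"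
        by (intro power_mono) auto
      then show "norm ((1 + norm (Y t \<omega>)) ^ q) \<le> norm ((1 + bound_const * (1 + c)) ^ q * (1 + U \<omega>) ^ q)"
        by (simp add: power_mult_distrib)
    qed
  qed
qed

lemma measurable_heat_poly:
  assumes "f \<in> borel_measurable N" shows "(\<lambda>\<omega>. heat_poly k (u, f \<omega>)) \<in> borel_measurable N"
proof -
  have "(\<lambda>v. heat_poly k (u, v)) \<in> borel_measurable borel"
    by (intro borel_measurable_continuous_onI continuous_on_compose2[OF continuous_on_heat_poly[of UNIV]])
       (auto intro!: continuous_intros)
  from measurable_compose[OF assms this] show ?thesis .
qed

text \<open>
  The increments of the process over the grid, minus increments that have conditional mean zero.
  Along almost every path this is the Riemann sum of the chain rule.
\<close>

definition martingale_remainder :: "nat \<Rightarrow> real \<Rightarrow> real \<Rightarrow> nat \<Rightarrow> 'a \<Rightarrow> real" where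
  "martingale_remainder k s t n \<omega> = (\<Sum>j\<le>n. heat_poly k (mesh s t n (Suc j), Y (mesh s t n (Suc j)) \<omega>)
     - heat_poly k (mesh s t n j, Y (mesh s t n j) \<omega> + c *\<^sub>R (B (mesh s t n (Suc j)) \<omega> - B (mesh s t n j) \<omega>)))"

lemma martingale_remainder_eq_heat_sum:
  assumes "drift_path (\<lambda>t. Y t \<omega>) (\<lambda>t. c *\<^sub>R B t \<omega>) x\<^sub>0 t"
  shows "martingale_remainder k s t n \<omega> = drift_path.heat_sum (\<lambda>t. Y t \<omega>) (\<lambda>t. c *\<^sub>R B t \<omega>) t k s n"
  unfolding martingale_remainder_def drift_path.heat_sum_def[OF assms] by (simp add: scaleR_diff_right)

text \<open>
  The grid increments telescope, and the compensating terms have mean zero on \<open>A\<close>. The value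
  does not depend on \<open>n\<close>, so its limit determines it.
\<close>

lemma expectation_martingale_remainder:
  assumes st: "0 \<le> s" "s < t" and A: "A \<in> sets (\<F> s)"
  shows "expectation (\<lambda>\<omega>. indicator A \<omega> * martingale_remainder k s t n \<omega>)
       = expectation (\<lambda>\<omega>. indicator A \<omega> * heat_poly k (t, Y t \<omega>))
         - expectation (\<lambda>\<omega>. indicator A \<omega> * heat_poly k (s, Y s \<omega>))"
proof -
  let ?p = "mesh s t n"
  let ?\<phi> = "\<lambda>u. expectation (\<lambda>\<omega>. indicator A \<omega> * heat_poly k (u, Y u \<omega>))"
  let ?a = "\<lambda>j \<omega>. indicator A \<omega> * heat_poly k (?p (Suc j), Y (?p (Suc j)) \<omega>)"
  let ?b = "\<lambda>j \<omega>. indicator A \<omega> * heat_poly k (?p j, Y (?p j) \<omega> + c *\<^sub>R (B (?p (Suc j)) \<omega> - B (?p j) \<omega>))"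
  have step: "?p j < ?p (Suc j)" for j
    using mesh_step[of s t n j] st by (smt (verit) divide_pos_pos of_nat_0_less_iff zero_less_Suc)
  have sp: "s \<le> ?p j" for j using mesh_mono[of s t 0 j n] st by simp
  have p0: "0 \<le> ?p j" for j using sp[of j] st by linarith
  have Ap: "A \<in> sets (\<F> (?p j))" for j
    using subalgebra_canonical_mono[OF sp[of j]] A by (auto simp: subalgebra_def)
  note inc = heat_poly_plus_increment[OF p0 step Ap measurable_Y[OF p0] integrable_Y_moment[OF p0]]
  have "expectation (\<lambda>\<omega>. indicator A \<omega> * martingale_remainder k s t n \<omega>)
      = expectation (\<lambda>\<omega>. \<Sum>j\<le>n. ?a j \<omega> - ?b j \<omega>)"
    by (simp add: martingale_remainder_def sum_distrib_left right_diff_distrib)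
  also have "\<dots> = (\<Sum>j\<le>n. expectation (?a j) - expectation (?b j))"
    by (simp only: Bochner_Integration.integral_sum[OF Bochner_Integration.integrable_diff[OF inc(2) inc(1)]]
        Bochner_Integration.integral_diff[OF inc(2) inc(1)])
  also have "\<dots> = (\<Sum>j\<le>n. ?\<phi> (?p (Suc j)) - ?\<phi> (?p j))"
    by (simp only: inc(3))
  also have "\<dots> = ?\<phi> t - ?\<phi> s"
    using sum_telescope[of "\<lambda>j. - ?\<phi> (?p j)" n] by simp
  finally show ?thesis .
qed

lemma expectation_martingale_remainder_tendsto_0:
  assumes st: "0 \<le> s" "s < t" and A: "A \<in> sets (\<F> s)" and k: "k \<le> CARD('n)"
  shows "(\<lambda>n. expectation (\<lambda>\<omega>. indicator A \<omega> * martingale_remainder k s t n \<omega>)) \<longlonglongrightarrow> 0"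
proof -
  have t: "0 < t" using st by simp
  have t0: "0 \<le> t" using st by simp
  obtain C q where C: "C \<ge> 0" "\<And>z :: real \<times> (real ^ 'n::{finite,linorder}). norm (heat_gradient k z) \<le> C * (1 + norm z) ^ q"
    using poly_growthE[OF poly_growth_heat_gradient] by blast
  obtain U where U: "U \<in> borel_measurable M" "\<And>\<omega>. 0 \<le> U \<omega>" "integrable M (\<lambda>\<omega>. (1 + U \<omega>) ^ (q + 2))"
    "AE \<omega> in M. drift_path (\<lambda>t. Y t \<omega>) (\<lambda>t. c *\<^sub>R B t \<omega>) x\<^sub>0 t \<and> (\<forall>u\<in>{0..t}. norm (c *\<^sub>R B u \<omega>) \<le> c * U \<omega>)"
    by (rule dominating_variable[OF t, of "q + 2"]) (rule that)
  define K where "K = drift_path.bound_const x\<^sub>0 t"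
  \<comment> \<open>Chosen so that \<open>1 + 2 * R \<le> E * (1 + U)\<close> for the radius \<open>R = t + K * (1 + c * U)\<close> of the uniform bound.\<close>
  define E where "E = 1 + 2 * t + 2 * K * (1 + c)"
  have p0: "0 \<le> mesh s t n j" for n j using mesh_mono[of s t 0 j n] st by simp
  have A_M [measurable]: "A \<in> sets M" using subalgebra_canonical[of s] A by (auto simp: subalgebra_def)
  have Ym: "Y u \<in> borel_measurable M" if "0 \<le> u" for u by (rule canonical_measurable[OF measurable_Y[OF that]])
  have meas: "martingale_remainder k s t n \<in> borel_measurable M" for n
    unfolding martingale_remainder_def
    by (intro borel_measurable_sum borel_measurable_diff measurable_heat_poly borel_measurable_add
        borel_measurable_scaleR borel_measurable_const Ym measurable_B p0)
  have "(\<lambda>n. expectation (\<lambda>\<omega>. indicator A \<omega> * martingale_remainder k s t n \<omega>)) \<longlonglongrightarrow> expectation (\<lambda>_. 0)"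
  proof (rule integral_dominated_convergence)
    show "(\<lambda>\<omega>. indicator A \<omega> * martingale_remainder k s t n \<omega>) \<in> borel_measurable M" for n
      using meas[of n] by measurable
    show "integrable M (\<lambda>\<omega>. C * E ^ (q + 2) * (1 + U \<omega>) ^ (q + 2))"
      using U(3) by (rule integrable_mult_right)
    show "AE \<omega> in M. (\<lambda>n. indicator A \<omega> * martingale_remainder k s t n \<omega>) \<longlonglongrightarrow> 0"
      using U(4)
    proof eventually_elim
      fix \<omega> assume \<omega>: "drift_path (\<lambda>t. Y t \<omega>) (\<lambda>t. c *\<^sub>R B t \<omega>) x\<^sub>0 t \<and> (\<forall>u\<in>{0..t}. norm (c *\<^sub>R B u \<omega>) \<le> c * U \<omega>)"
      then have dp: "drift_path (\<lambda>t. Y t \<omega>) (\<lambda>t. c *\<^sub>R B t \<omega>) x\<^sub>0 t" ..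
      have "(\<lambda>n. martingale_remainder k s t n \<omega>) \<longlonglongrightarrow> 0"
        unfolding martingale_remainder_eq_heat_sum[OF dp]
        using drift_path.heat_sum_tendsto_0[OF dp st(1) _ k] st by simp
      then show "(\<lambda>n. indicator A \<omega> * martingale_remainder k s t n \<omega>) \<longlonglongrightarrow> 0"
        by (rule tendsto_mult_right_zero)
    qed
    show "AE \<omega> in M. norm (indicator A \<omega> * martingale_remainder k s t n \<omega>) \<le> C * E ^ (q + 2) * (1 + U \<omega>) ^ (q + 2)" for n
      using U(4)
    proof eventually_elim
      fix \<omega> assume \<omega>: "drift_path (\<lambda>t. Y t \<omega>) (\<lambda>t. c *\<^sub>R B t \<omega>) x\<^sub>0 t \<and> (\<forall>u\<in>{0..t}. norm (c *\<^sub>R B u \<omega>) \<le> c * U \<omega>)"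
      then have dp: "drift_path (\<lambda>t. Y t \<omega>) (\<lambda>t. c *\<^sub>R B t \<omega>) x\<^sub>0 t" ..
      have K1: "1 \<le> K" unfolding K_def by (rule drift_path.bound_const_ge_1[OF dp])
      define L where "L = K * (1 + c * U \<omega>)"
      have U0: "0 \<le> U \<omega>" by (rule U)
      have L0: "0 \<le> L" using K1 c_pos U0 by (simp add: L_def)
      have L1: "L \<le> K * ((1 + c) * (1 + U \<omega>))"
        unfolding L_def using K1 c_pos U0 by (intro mult_left_mono) (auto simp: algebra_simps)
      have t1: "1 + 2 * t \<le> (1 + 2 * t) * (1 + U \<omega>)"
        using t0 U0 by (simp add: algebra_simps)
      have EL: "1 + 2 * (t + L) \<le> E * (1 + U \<omega>)"
      proof -
        have "E * (1 + U \<omega>) = (1 + 2 * t) * (1 + U \<omega>) + 2 * (K * ((1 + c) * (1 + U \<omega>)))"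
          by (simp add: E_def algebra_simps)
        moreover have "(1 + 2 * t) + 2 * L \<le> (1 + 2 * t) * (1 + U \<omega>) + 2 * (K * ((1 + c) * (1 + U \<omega>)))"
          using L1 t1 by (intro add_mono mult_left_mono) auto
        ultimately show ?thesis by simp
      qed
      have quad: "t + L\<^sup>2 \<le> (1 + 2 * (t + L))\<^sup>2"
      proof -
        have "(1 + 2 * (t + L))\<^sup>2 = 1 + 4 * t + 4 * L + 4 * t\<^sup>2 + 8 * (t * L) + 4 * L\<^sup>2"
          by (simp add: power2_eq_square algebra_simps)
        moreover have "0 \<le> t * L" "0 \<le> t\<^sup>2" "0 \<le> L\<^sup>2" using t0 L0 by simp_all
        ultimately show ?thesis using t0 L0 by linarith
      qed
      have "\<bar>martingale_remainder k s t n \<omega>\<bar> \<le> C * (1 + 2 * (t + L)) ^ q * (t + L\<^sup>2)"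
        unfolding martingale_remainder_eq_heat_sum[OF dp] L_def K_def
        by (rule drift_path.heat_sum_bound[OF dp st(1)]) (use st \<omega> C in auto)
      also have "\<dots> \<le> C * (1 + 2 * (t + L)) ^ q * (1 + 2 * (t + L))\<^sup>2"
        using quad C(1) t0 L0 by (intro mult_left_mono) auto
      also have "\<dots> = C * (1 + 2 * (t + L)) ^ (q + 2)" by (simp only: power_add mult.assoc)
      also have "\<dots> \<le> C * (E * (1 + U \<omega>)) ^ (q + 2)"
        using EL C(1) t0 L0 by (intro mult_left_mono power_mono) auto
      also have "\<dots> = C * E ^ (q + 2) * (1 + U \<omega>) ^ (q + 2)" by (simp only: power_mult_distrib mult.assoc)
      finally have "\<bar>martingale_remainder k s t n \<omega>\<bar> \<le> C * E ^ (q + 2) * (1 + U \<omega>) ^ (q + 2)" .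
      moreover have "norm (indicator A \<omega> * martingale_remainder k s t n \<omega>) \<le> \<bar>martingale_remainder k s t n \<omega>\<bar>"
        by (simp add: indicator_def)
      ultimately show "norm (indicator A \<omega> * martingale_remainder k s t n \<omega>) \<le> C * E ^ (q + 2) * (1 + U \<omega>) ^ (q + 2)"
        by linarith
    qed
  qed simp
  then show ?thesis by simp
qed

lemma martingale_heat_poly:
  assumes k: "k \<le> CARD('n)"
  shows "martingale M \<F> (\<lambda>t \<omega>. heat_poly k (t, Y t \<omega>))"
proof -
  have int: "integrable M (\<lambda>\<omega>. heat_poly k (t, Y t \<omega>))" if t: "0 \<le> t" for t
  proof -
    have "space M \<in> sets (\<F> t)" using sets.top[of "\<F> t"] by simp
    then have "integrable M (\<lambda>\<omega>. indicator (space M) \<omega> * heat_poly k (t, Y t \<omega>))"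
      using heat_poly_plus_increment(2)[of t "t + 1" "space M" "Y t" k t] t measurable_Y[OF t] integrable_Y_moment[OF t] by simp
    then show ?thesis by (rule Bochner_Integration.integrable_cong[THEN iffD1, rotated 2]) auto
  qed
  have meas: "(\<lambda>\<omega>. heat_poly k (t, Y t \<omega>)) \<in> borel_measurable (\<F> t)" if "0 \<le> t" for t
    by (rule measurable_heat_poly[OF measurable_Y[OF that]])
  have cond: "AE \<omega> in M. real_cond_exp M (\<F> s) (\<lambda>\<omega>. heat_poly k (t, Y t \<omega>)) \<omega> = heat_poly k (s, Y s \<omega>)"
    if st: "0 \<le> s" "s \<le> t" for s t
  proof -
    have t: "0 \<le> t" using st by simp
    interpret finite_measure_subalgebra M "\<F> s"
      by standard (rule subalgebra_canonical)
    show ?thesis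
    proof (rule real_cond_exp_charact[OF _ int[OF t] int[OF st(1)] meas[OF st(1)]])
      fix A assume A: "A \<in> sets (\<F> s)"
      have "expectation (\<lambda>\<omega>. indicator A \<omega> * heat_poly k (t, Y t \<omega>)) = expectation (\<lambda>\<omega>. indicator A \<omega> * heat_poly k (s, Y s \<omega>))"
      proof (cases "s = t")
        case False
        then have lt: "s < t" using st by simp
        have "(\<lambda>n :: nat. expectation (\<lambda>\<omega>. indicator A \<omega> * heat_poly k (t, Y t \<omega>))
            - expectation (\<lambda>\<omega>. indicator A \<omega> * heat_poly k (s, Y s \<omega>))) \<longlonglongrightarrow> 0"
          using expectation_martingale_remainder_tendsto_0[OF st(1) lt A k]
          unfolding expectation_martingale_remainder[OF st(1) lt A] .
        then show ?thesis by (simp add: LIMSEQ_const_iff)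
      qed simp
      then show "(LINT \<omega>:A|M. heat_poly k (t, Y t \<omega>)) = (LINT \<omega>:A|M. heat_poly k (s, Y s \<omega>))"
        by (simp add: set_lebesgue_integral_def)
    qed
  qed
  show ?thesis
    unfolding martingale_def
    using subalgebra_canonical subalgebra_canonical_mono meas int cond by blast
qed

end

theorem proposition2p3:
  fixes M :: "'a measure"
    and B X :: "real \<Rightarrow> 'a \<Rightarrow> real ^ 'n::{finite,linorder}"
    and x\<^sub>0 :: "real ^ 'n::{finite,linorder}"
    and \<beta> :: real and k :: nat
  assumes "prob_space M"
    and "brownian_motion M B"
    and "CARD('n) \<ge> 2"
    and "\<beta> > 0"
    and "1 \<le> k" and "k \<le> CARD('n)"
    and "x\<^sub>0 \<in> chamber_A"
    and "bessel_process_A M B \<beta> (sqrt \<beta> *\<^sub>R x\<^sub>0) X"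
  shows "martingale M (canonical_filtration M B)
    (\<lambda>t \<omega>. esym k (renormalize \<beta> X t \<omega>) +
       (\<Sum>l = 1..k div 2. fact (CARD('n) - k + 2 * l) / (2 ^ l * fact l * fact (CARD('n) - k))
          * t ^ l * esym (k - 2 * l) (renormalize \<beta> X t \<omega>)))"
proof -
  interpret prob_space M by fact
  interpret renormalized_bessel M B X \<beta> x\<^sub>0
    by standard (use assms in auto)
  have "{..k div 2} = insert 0 {1..k div 2}" by auto
  then have "heat_poly k (t, Y t \<omega>) = esym k (Y t \<omega>) +
       (\<Sum>l = 1..k div 2. fact (CARD('n) - k + 2 * l) / (2 ^ l * fact l * fact (CARD('n) - k))
          * t ^ l * esym (k - 2 * l) (Y t \<omega>))" for t \<omega>
    by (simp add: heat_poly_def heat_coeff_def)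
  then show ?thesis using martingale_heat_poly[OF assms(6)] by simp
qed

end
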